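(* Let $W=W^{(1)}+\mathrm{i}W^{(2)}$ be a complex standard Brownian motion with respect to a filtration $\{\mathcal{F}_t\}$ satisfying the usual conditions. Then for every moderate function $F$ there exist two constants $c_F,C_F>0$ such that for every stopping time $\tau$ with respect to $\{\mathcal{F}_t\}$, $$c_F\,\mathbb{E}F(\sqrt{\tau})\le\mathbb{E}F\Bigl(\max_{0\le t\le\tau}|W_t|\Bigr)\le C_F\,\mathbb{E}F(\sqrt{\tau})$$ and $$c_F\,\mathbb{E}F\Bigl(\log^{1/2}\bigl(1+\log(1+\tau)\bigr)\Bigr)\le\mathbb{E}F\biggl(\max_{0\le t\le\tau}\frac{|W_t|}{\sqrt{1+t}}\biggr)\le C_F\,\mathbb{E}F\Bigl(\log^{1/2}\bigl(1+\log(1+\tau)\bigr)\Bigr).$$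
   Context: $\mathbb{R}_+=[0,\infty)$. A function $F:\mathbb{R}_+\to\mathbb{R}_+$ is called moderate if (a) it is continuous, increasing (in the weak sense) and $F(0)=0$, and (b) there exists $\beta>1$ such that $\sup_{x>0}F(\beta x)/F(x)<\infty$, with the conventions $0/0=1$ and $x/0=\infty$ for $x>0$. Notation: $\log^{1/2}(u)=(\log u)^{1/2}$. A complex standard Brownian motion is $W=W^{(1)}+\mathrm{i}W^{(2)}$ with $W^{(1)},W^{(2)}$ independent real standard Brownian motions with respect to $\{\mathcal{F}_t\}$ (so $(W^{(1)},W^{(2)})$ is a two-dimensional standard $\{\mathcal{F}_t\}$-Brownian motion starting from $0$). *)

theory Defs
  imports "HOL-Probability.Probability"
begin

text \<open>
  Time is indexed by \<open>[0, \<infinity>] = ennreal\<close>, so that the library's \<^const>\<open>stopping_time\<close> covers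
  stopping times that may take the value \<open>\<infinity>\<close>.  The \<open>\<sigma>\<close>-algebra at index \<open>\<infinity>\<close> is an arbitrary
  sub-\<open>\<sigma>\<close>-algebra of \<open>M\<close> containing all the others; it places no constraint on stopping times.
  Only the \<open>\<sigma>\<close>-algebras and not the measures of the \<open>\<F> t\<close> are relevant.
\<close>

definition usual_conditions :: "'a measure \<Rightarrow> (ennreal \<Rightarrow> 'a measure) \<Rightarrow> bool" where
  "usual_conditions M \<F> \<longleftrightarrow>
     filtration (space M) \<F> \<and>
     (\<forall>t. subalgebra M (\<F> t)) \<and>
     complete_measure M \<and>
     null_sets M \<subseteq> sets (\<F> 0) \<and>
     (\<forall>t<\<infinity>. sets (\<F> t) = (\<Inter>s\<in>{t<..}. sets (\<F> s)))"

text \<open>Only the values \<open>B t\<close> for \<open>t \<ge> 0\<close> are relevant.\<close>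

definition standard_BM :: "'a measure \<Rightarrow> (ennreal \<Rightarrow> 'a measure) \<Rightarrow> (real \<Rightarrow> 'a \<Rightarrow> real) \<Rightarrow> bool" where
  "standard_BM M \<F> B \<longleftrightarrow>
     (\<forall>t\<ge>0. B t \<in> borel_measurable (\<F> (ennreal t))) \<and>
     (AE \<omega> in M. B 0 \<omega> = 0) \<and>
     (AE \<omega> in M. continuous_on {0..} (\<lambda>t. B t \<omega>)) \<and>
     (\<forall>s t. 0 \<le> s \<and> s < t \<longrightarrow>
        prob_space.indep_set M (sets (\<F> (ennreal s)))
          (sets (vimage_algebra (space M) (\<lambda>\<omega>. B t \<omega> - B s \<omega>) borel)) \<and>
        distributed M lborel (\<lambda>\<omega>. B t \<omega> - B s \<omega>) (normal_density 0 (sqrt (t - s))))"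

text \<open>
  The real and imaginary parts are independent as processes, i.e. as random elements of
  \<open>\<real>\<^bsup>[0,\<infinity>)\<^esup>\<close> with the product \<open>\<sigma>\<close>-algebra.
\<close>

definition complex_standard_BM ::
    "'a measure \<Rightarrow> (ennreal \<Rightarrow> 'a measure) \<Rightarrow> (real \<Rightarrow> 'a \<Rightarrow> complex) \<Rightarrow> bool" where
  "complex_standard_BM M \<F> W \<longleftrightarrow>
     standard_BM M \<F> (\<lambda>t \<omega>. Re (W t \<omega>)) \<and>
     standard_BM M \<F> (\<lambda>t \<omega>. Im (W t \<omega>)) \<and>
     prob_space.indep_var M
       (\<Pi>\<^sub>M t\<in>{0..}. borel) (\<lambda>\<omega>. \<lambda>t\<in>{0..}. Re (W t \<omega>))
       (\<Pi>\<^sub>M t\<in>{0..}. borel) (\<lambda>\<omega>. \<lambda>t\<in>{0..}. Im (W t \<omega>))"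

text \<open>The library has \<open>0 / 0 = 0\<close> in \<^typ>\<open>ennreal\<close>, whereas \<open>x / 0 = \<infinity>\<close> for \<open>x > 0\<close> as required.\<close>

definition growth_ratio :: "real \<Rightarrow> real \<Rightarrow> ennreal" where
  "growth_ratio a b = (if a = 0 \<and> b = 0 then 1 else ennreal a / ennreal b)"

definition moderate :: "(real \<Rightarrow> real) \<Rightarrow> bool" where
  "moderate F \<longleftrightarrow>
     F \<in> {0..} \<rightarrow> {0..} \<and> continuous_on {0..} F \<and> mono_on {0..} F \<and> F 0 = 0 \<and>
     (\<exists>\<beta>>1. (SUP x\<in>{0<..}. growth_ratio (F (\<beta> * x)) (F x)) < \<infinity>)"

text \<open>
  Extension of a nondecreasing function \<open>[0,\<infinity>) \<rightarrow> [0,\<infinity>)\<close> to \<open>[0,\<infinity>]\<close> by its limit at \<open>\<infinity>\<close>;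
  the extension is needed where a stopping time or a running maximum is infinite.
\<close>

definition extend :: "(real \<Rightarrow> real) \<Rightarrow> ennreal \<Rightarrow> ennreal" where
  "extend g x = (if x = \<infinity> then (SUP y\<in>{0..}. ennreal (g y)) else ennreal (g (enn2real x)))"

text \<open>
  The supremum is over real times only.  It is an attained maximum if \<open>\<tau>\<close> is finite
  and the path is continuous.
\<close>

definition running_max :: "(real \<Rightarrow> real) \<Rightarrow> ennreal \<Rightarrow> ennreal" where
  "running_max g \<tau> = (SUP t\<in>{t. 0 \<le> t \<and> ennreal t \<le> \<tau>}. ennreal (g t))"

end

theory Submission
  imports Defs "HOL-Real_Asymp.Real_Asymp"
begin

text \<open>
  For a real Brownian motion \<open>B\<close>, consider the running maximum \<open>Y\<close> of \<open>\<bar>B t\<bar> / w t\<close> up to \<open>\<tau>\<close> and the clock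
  \<open>X = g \<tau>\<close>, where either \<open>w = 1\<close> and \<open>g = sqrt\<close>, or \<open>w t = sqrt (1 + t)\<close> and
  \<open>g t = sqrt (ln (1 + ln (1 + t)))\<close>.  The modulus of a complex number lies between the modulus of its real part and twice the
  larger one of the moduli of its two parts, and a moderate function satisfies \<open>F (2 x) \<le> K F x\<close>.  So it is enough
  to compare \<open>F (X)\<close> and \<open>F (Y)\<close> in one dimension (\<open>complex_BM_moderate_comparison\<close>).

  In both directions the comparison comes from a good-lambda inequality in the manner of Burkholder: for every
  \<open>\<epsilon> > 0\<close> there is \<open>\<delta> > 0\<close> such that the event \<open>Y > 2 \<theta>\<close>, \<open>X \<le> \<delta> \<theta>\<close> has probability at most \<open>\<epsilon>\<close> times that of
  \<open>Y \<ge> \<theta>\<close>, for all levels \<open>\<theta>\<close> and all stopping times, and likewise with \<open>X\<close> and \<open>Y\<close> exchanged.  Integrating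
  this over the levels of \<open>F\<close> and choosing \<open>\<epsilon> \<le> 1 / (2 K)\<close> gives the claim (\<open>good_lambda_moderate\<close>).

  If the clock is small, then \<open>\<tau>\<close> is below a deterministic time \<open>u\<close>.  After \<open>\<bar>B\<bar> / w\<close> has passed \<open>\<theta>\<close>, the path
  still has to move by a multiple of \<open>\<theta> w\<close> before \<open>u\<close>, independently of its past (\<open>upper_good_lambda\<close>).  For
  \<open>w = 1\<close> this is unlikely by a maximal inequality.  For the other weight and large \<open>\<theta>\<close>, the same inequality is
  used on each of at most \<open>1 + ln (1 + u)\<close> geometric scales.  With \<open>g u = \<delta> \<theta>\<close> this number is
  \<open>exp (\<delta>\<^sup>2 \<theta>\<^sup>2)\<close>, whereas the probability on each scale is of order \<open>exp (- c \<theta>\<^sup>2)\<close> with \<open>c\<close> independent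
  of \<open>\<delta>\<close>.

  If the clock exceeds \<open>2 \<theta>\<close>, then \<open>\<tau>\<close> exceeds a deterministic time \<open>u\<close>, and the event that the clock exceeds
  \<open>\<theta>\<close> belongs to the past of a deterministic time \<open>s < u\<close>.  A small maximum forces the increments between \<open>s\<close>
  and \<open>u\<close> to be small, which is unlikely independently of that past (\<open>lower_good_lambda_single\<close>,
  \<open>lower_good_lambda_increments\<close>).  For the iterated logarithm and large \<open>\<theta>\<close>, a single increment is not
  enough, because it violates its bound only with a small probability; but there are so many geometrically
  growing times between \<open>s\<close> and \<open>u\<close> that some increment very likely does.
\<close>

section \<open>Moderate functions\<close>

lemma growth_ratio_bound:
  assumes "0 \<le> a" "0 \<le> b" "growth_ratio a b \<le> ennreal K" "1 \<le> K"
  shows "a \<le> K * b"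
proof (cases "b = 0")
  case True
  then show ?thesis
    using assms by (cases "a = 0") (auto simp: growth_ratio_def top_unique)
next
  case False
  then have "ennreal (a / b) \<le> ennreal K"
    using assms by (simp add: growth_ratio_def divide_ennreal)
  then show ?thesis
    using False assms by (simp add: ennreal_le_iff divide_le_eq)
qed

text \<open>
  Moderate growth along one factor \<open>\<beta> > 1\<close> gives moderate growth along every factor, by iterating until
  \<open>\<beta>\<^sup>n\<close> exceeds it.  The conventions for the quotient \<open>F (\<beta> x) / F x\<close> matter here: \<open>F x = 0 < F (\<beta> x)\<close>
  makes the supremum infinite and so is excluded.
\<close>

lemma moderate_scaling:
  assumes "moderate F" "0 \<le> c"
  shows "\<exists>K\<ge>1. \<forall>x\<ge>0. F (c * x) \<le> K * F x"
proof -
  have Fnn: "\<And>x. 0 \<le> x \<Longrightarrow> 0 \<le> F x" and Fm: "mono_on {0..} F" and F0: "F 0 = 0"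
    using assms(1) by (auto simp: moderate_def)
  obtain \<beta> where \<beta>: "\<beta> > 1" "(SUP x\<in>{0<..}. growth_ratio (F (\<beta> * x)) (F x)) < \<infinity>"
    using assms(1) by (auto simp: moderate_def)
  define K where "K = max 1 (enn2real (SUP x\<in>{0<..}. growth_ratio (F (\<beta> * x)) (F x)))"
  have K: "F (\<beta> * x) \<le> K * F x" if "x \<ge> 0" for x
  proof (cases "x = 0")
    case True
    then show ?thesis by (simp add: F0)
  next
    case False
    have "growth_ratio (F (\<beta> * x)) (F x) \<le> (SUP x\<in>{0<..}. growth_ratio (F (\<beta> * x)) (F x))"
      using False that by (intro SUP_upper) auto
    also have "\<dots> = ennreal (enn2real (SUP x\<in>{0<..}. growth_ratio (F (\<beta> * x)) (F x)))"
      using \<beta>(2) by (simp add: less_top)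
    also have "\<dots> \<le> ennreal K"
      unfolding K_def by (intro ennreal_leI) simp
    finally show ?thesis
      using that \<beta> Fnn by (intro growth_ratio_bound) (auto simp: K_def)
  qed
  have iter: "F (\<beta> ^ n * x) \<le> K ^ n * F x" if "x \<ge> 0" for n x
  proof (induction n)
    case (Suc n)
    have "F (\<beta> ^ Suc n * x) \<le> K * F (\<beta> ^ n * x)"
      using K[of "\<beta> ^ n * x"] \<beta> that by (simp add: mult.assoc)
    also have "\<dots> \<le> K * (K ^ n * F x)"
      using Suc by (intro mult_left_mono) (auto simp: K_def)
    finally show ?case by simp
  qed simp
  obtain n where n: "c < \<beta> ^ n"
    using real_arch_pow[OF \<beta>(1)] by blast
  have "F (c * x) \<le> K ^ n * F x" if "x \<ge> 0" for x
  proof -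
    have "F (c * x) \<le> F (\<beta> ^ n * x)"
      using n that \<beta> assms(2) by (intro mono_onD[OF Fm]) (auto intro!: mult_right_mono)
    with iter[OF that, of n] show ?thesis by simp
  qed
  moreover have "1 \<le> K ^ n"
    by (simp add: K_def)
  ultimately show ?thesis by blast
qed

lemma extend_real [simp]: "0 \<le> x \<Longrightarrow> extend g (ennreal x) = ennreal (g x)"
  by (simp add: extend_def)

lemma extend_mono:
  assumes "mono_on {0..} g" "x \<le> y"
  shows "extend g x \<le> extend g y"
proof (cases y)
  case (real b)
  then obtain a where a: "x = ennreal a" "a \<ge> 0"
    using assms(2) by (cases x) (auto simp: top_unique)
  then show ?thesis
    using real assms by (auto intro!: ennreal_leI mono_onD[OF assms(1)])
next
  case top
  show ?thesis
  proof (cases x)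
    case (real a)
    then have "extend g x \<le> (SUP y\<in>{0..}. ennreal (g y))"
      by (auto intro!: SUP_upper2[of a])
    then show ?thesis using top by (simp add: extend_def)
  qed (use top in simp)
qed

lemma borel_measurable_extend:
  assumes "continuous_on {0..} g"
  shows "extend g \<in> borel_measurable borel"
proof -
  have "continuous_on UNIV (\<lambda>x. g (max 0 x))"
    by (intro continuous_on_compose2[OF assms]) (auto intro!: continuous_intros)
  then have [measurable]: "(\<lambda>x. g (max 0 x)) \<in> borel_measurable borel"
    by (rule borel_measurable_continuous_onI)
  have "(\<lambda>x. if x = \<infinity> then (SUP y\<in>{0..}. ennreal (g y)) else ennreal (g (max 0 (enn2real x))))
      \<in> borel_measurable borel"
    by measurable
  also have "(\<lambda>x. if x = \<infinity> then (SUP y\<in>{0..}. ennreal (g y)) else ennreal (g (max 0 (enn2real x))))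
      = extend g"
    by (auto simp: extend_def fun_eq_iff max_def)
  finally show ?thesis .
qed

lemma extend_scaling:
  assumes "moderate F" "0 < c" "1 \<le> K" "\<forall>x\<ge>0. F (c * x) \<le> K * F x"
  shows "extend F (ennreal c * x) \<le> ennreal K * extend F x"
proof (cases x)
  case (real a)
  have "ennreal c * x = ennreal (c * a)"
    using real assms by (simp add: ennreal_mult)
  moreover have "ennreal (F (c * a)) \<le> ennreal K * ennreal (F a)"
    using real assms by (auto simp: ennreal_mult'[symmetric] intro!: ennreal_leI)
  ultimately show ?thesis
    using real assms by simp
next
  case top
  then have "ennreal c * x = x"
    using assms by (simp add: ennreal_mult_top)
  then show ?thesis
    using assms mult_right_mono[of 1 "ennreal K" "extend F x"] by simp
qed

text \<open>
  An increasing clock \<open>g\<close> turns a level of \<open>g (\<tau>)\<close> into a deterministic time, also where \<open>\<tau> = \<infinity>\<close>.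
\<close>

lemma extend_le_iff:
  assumes "strict_mono_on {0..} g" "\<And>t. 0 \<le> t \<Longrightarrow> 0 \<le> g t" "0 \<le> u"
  shows "extend g t \<le> ennreal (g u) \<longleftrightarrow> t \<le> ennreal u"
proof (cases t)
  case (real a)
  then show ?thesis
    using assms strict_mono_on_less_eq[OF assms(1), of a u] by (simp add: ennreal_le_iff)
next
  case top
  have "g u < g (u + 1)"
    using assms(3) by (intro strict_mono_onD[OF assms(1)]) auto
  then have "ennreal (g u) < ennreal (g (u + 1))"
    using assms(2)[OF assms(3)] by (simp add: ennreal_less_iff)
  also have "\<dots> \<le> extend g t"
    using top assms(3) by (auto simp: extend_def intro!: SUP_upper2[of "u + 1"])
  finally show ?thesis using top by (auto simp: top_unique)
qed

section \<open>Good-lambda inequalities\<close>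

lemma min_ennreal_eq_nn_integral:
  fixes n :: real
  assumes "0 < n"
  shows "min f (ennreal n) = (\<integral>\<^sup>+r. indicator {r. ennreal r < f} r * indicator {0<..<n} r \<partial>lborel)"
    and "min f (ennreal n) = (\<integral>\<^sup>+r. indicator {r. ennreal r \<le> f} r * indicator {0<..<n} r \<partial>lborel)"
proof -
  have "(\<integral>\<^sup>+r. indicator {r. ennreal r < f} r * indicator {0<..<n} r \<partial>lborel) = min f (ennreal n) \<and>
   (\<integral>\<^sup>+r. indicator {r. ennreal r \<le> f} r * indicator {0<..<n} r \<partial>lborel) = min f (ennreal n)"
  proof (cases f)
    case (real a)
    have 1: "indicator {r. ennreal r < f} r * indicator {0<..<n} r = (indicator {0<..<min a n} r::ennreal)" for r
      using real by (cases "r > 0") (auto simp: indicator_def ennreal_less_iff)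
    have 2: "AE r in lborel. indicator {r. ennreal r \<le> f} r * indicator {0<..<n} r = (indicator {0<..<min a n} r::ennreal)"
      using AE_lborel_singleton[of a]
    proof eventually_elim
      case (elim r)
      then show ?case
        using real by (cases "r > 0") (auto simp: indicator_def)
    qed
    have 3: "(\<integral>\<^sup>+r. (indicator {0<..<min a n} r::ennreal) \<partial>lborel) = min f (ennreal n)"
      using real assms by (auto simp: min_def)
    show ?thesis
      unfolding nn_integral_cong_AE[OF 2] unfolding 1 using 3 by simp
  next
    case top
    have 1: "{r. ennreal r < f} = UNIV" "{r. ennreal r \<le> f} = UNIV"
      using top by auto
    show ?thesis
      unfolding 1 using assms top by (simp add: min_def top_unique)
  qed
  then show "min f (ennreal n) = (\<integral>\<^sup>+r. indicator {r. ennreal r < f} r * indicator {0<..<n} r \<partial>lborel)"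
    "min f (ennreal n) = (\<integral>\<^sup>+r. indicator {r. ennreal r \<le> f} r * indicator {0<..<n} r \<partial>lborel)"
    by simp_all
qed

lemma (in sigma_finite_measure) nn_integral_min_layer_cake:
  fixes n :: real
  assumes [measurable]: "f \<in> borel_measurable M" and "0 < n"
  shows "(\<integral>\<^sup>+\<omega>. min (f \<omega>) (ennreal n) \<partial>M) =
      (\<integral>\<^sup>+r. emeasure M {\<omega>\<in>space M. ennreal r < f \<omega>} * indicator {0<..<n} r \<partial>lborel)"
    and "(\<integral>\<^sup>+\<omega>. min (f \<omega>) (ennreal n) \<partial>M) =
      (\<integral>\<^sup>+r. emeasure M {\<omega>\<in>space M. ennreal r \<le> f \<omega>} * indicator {0<..<n} r \<partial>lborel)"
proof -
  interpret P: pair_sigma_finite M lborel ..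
  have *: "(\<integral>\<^sup>+\<omega>. indicator {r. Q r \<omega>} r * c \<partial>M) = emeasure M {\<omega>\<in>space M. Q r \<omega>} * c"
    if [measurable]: "{\<omega>\<in>space M. Q r \<omega>} \<in> sets M" for Q r and c :: ennreal
  proof -
    have "(\<integral>\<^sup>+\<omega>. indicator {r. Q r \<omega>} r * c \<partial>M) = (\<integral>\<^sup>+\<omega>. c * indicator {\<omega>\<in>space M. Q r \<omega>} \<omega> \<partial>M)"
      by (intro nn_integral_cong) (auto simp: indicator_def)
    then show ?thesis
      using that by (simp add: nn_integral_cmult_indicator mult.commute)
  qed
  have "(\<integral>\<^sup>+\<omega>. min (f \<omega>) (ennreal n) \<partial>M) =
      (\<integral>\<^sup>+r. (\<integral>\<^sup>+\<omega>. indicator {r. ennreal r < f \<omega>} r * indicator {0<..<n} r \<partial>M) \<partial>lborel)"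
    unfolding min_ennreal_eq_nn_integral(1)[OF assms(2)]
    by (subst P.Fubini') (auto simp: indicator_def[of "{r. _ r}"])
  then show "(\<integral>\<^sup>+\<omega>. min (f \<omega>) (ennreal n) \<partial>M) =
      (\<integral>\<^sup>+r. emeasure M {\<omega>\<in>space M. ennreal r < f \<omega>} * indicator {0<..<n} r \<partial>lborel)"
    by (subst (asm) *) auto
  have "(\<integral>\<^sup>+\<omega>. min (f \<omega>) (ennreal n) \<partial>M) =
      (\<integral>\<^sup>+r. (\<integral>\<^sup>+\<omega>. indicator {r. ennreal r \<le> f \<omega>} r * indicator {0<..<n} r \<partial>M) \<partial>lborel)"
    unfolding min_ennreal_eq_nn_integral(2)[OF assms(2)]
    by (subst P.Fubini') (auto simp: indicator_def[of "{r. _ r}"])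
  then show "(\<integral>\<^sup>+\<omega>. min (f \<omega>) (ennreal n) \<partial>M) =
      (\<integral>\<^sup>+r. emeasure M {\<omega>\<in>space M. ennreal r \<le> f \<omega>} * indicator {0<..<n} r \<partial>lborel)"
    by (subst (asm) *) auto
qed

text \<open>
  The control is uniform in the index \<open>i\<close> (below: a stopping time) and in the level \<open>\<theta>\<close>; only then does it
  integrate to a comparison whose constant does not depend on \<open>i\<close>.
\<close>

definition good_lambda ::
    "'a measure \<Rightarrow> 'b set \<Rightarrow> ('b \<Rightarrow> 'a \<Rightarrow> ennreal) \<Rightarrow> ('b \<Rightarrow> 'a \<Rightarrow> ennreal) \<Rightarrow> bool" where
  "good_lambda M I Y X \<longleftrightarrow> (\<forall>\<epsilon>>0. \<exists>\<delta>>0. \<forall>i\<in>I. \<forall>\<theta>>0.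
     measure M {\<omega>\<in>space M. ennreal (2 * \<theta>) < Y i \<omega> \<and> X i \<omega> \<le> ennreal (\<delta> * \<theta>)}
       \<le> \<epsilon> * measure M {\<omega>\<in>space M. ennreal \<theta> \<le> Y i \<omega>})"

text \<open>
  A level \<open>r\<close> of \<open>F\<close> is attained as \<open>r = F (2 \<theta>)\<close>.  If \<open>F (Y) > r\<close>, then \<open>Y > 2 \<theta>\<close>, and either
  \<open>X > \<delta> \<theta>\<close>, whence \<open>L F (X) \<ge> r\<close>, or the good-lambda inequality applies, and its right-hand side lives on
  \<open>Y \<ge> \<theta>\<close>, where \<open>K F (Y) \<ge> r\<close>.  Integrating over \<open>r\<close> bounds the integral of \<open>F (Y)\<close> by \<open>\<epsilon> K \<le> 1 / 2\<close> times
  itself plus \<open>L\<close> times the integral of \<open>F (X)\<close>, and the first term is absorbed.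
\<close>

lemma (in prob_space) good_lambda_integral:
  fixes X Y :: "'a \<Rightarrow> ennreal" and F :: "real \<Rightarrow> real"
  assumes F: "moderate F"
    and K: "1 \<le> K" "\<forall>x\<ge>0. F (2 * x) \<le> K * F x"
    and L: "1 \<le> L" "\<forall>x\<ge>0. F (2 / \<delta> * x) \<le> L * F x"
    and \<delta>: "0 < \<delta>" and \<epsilon>: "0 \<le> \<epsilon>" "\<epsilon> * K \<le> 1 / 2"
    and [measurable]: "X \<in> borel_measurable M" "Y \<in> borel_measurable M"
    and good: "\<And>\<theta>. 0 < \<theta> \<Longrightarrow>
      prob {\<omega>\<in>space M. ennreal (2 * \<theta>) < Y \<omega> \<and> X \<omega> \<le> ennreal (\<delta> * \<theta>)}
        \<le> \<epsilon> * prob {\<omega>\<in>space M. ennreal \<theta> \<le> Y \<omega>}"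
  shows "(\<integral>\<^sup>+\<omega>. extend F (Y \<omega>) \<partial>M) \<le> ennreal (2 * L) * (\<integral>\<^sup>+\<omega>. extend F (X \<omega>) \<partial>M)"
proof -
  have Fnn: "\<And>x. 0 \<le> x \<Longrightarrow> 0 \<le> F x" and Fm: "mono_on {0..} F" and F0: "F 0 = 0"
    and Fc: "continuous_on {0..} F"
    using F by (auto simp: moderate_def)
  have [measurable]: "extend F \<in> borel_measurable borel"
    by (rule borel_measurable_extend[OF Fc])
  have level: "emeasure M {\<omega>\<in>space M. ennreal r < extend F (Y \<omega>)}
      \<le> ennreal \<epsilon> * emeasure M {\<omega>\<in>space M. ennreal r \<le> ennreal K * extend F (Y \<omega>)}
        + emeasure M {\<omega>\<in>space M. ennreal r \<le> ennreal L * extend F (X \<omega>)}"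
    (is "_ \<le> ennreal \<epsilon> * emeasure M ?B + emeasure M ?C") if "0 < r" for r
  proof (cases "\<exists>x\<ge>0. r \<le> F x")
    case True
    then obtain x where x: "x \<ge> 0" "r \<le> F x" by blast
    have "\<exists>z\<ge>0. z \<le> x \<and> F z = r"
      using x that F0 by (intro IVT' continuous_on_subset[OF Fc]) auto
    then obtain z where z: "z \<ge> 0" "F z = r" by blast
    define \<theta> where "\<theta> = z / 2"
    have "z \<noteq> 0"
      using z F0 that by auto
    then have \<theta>: "\<theta> > 0" "F (2 * \<theta>) = r"
      using z by (auto simp: \<theta>_def)
    have 1: "ennreal (2 * \<theta>) < y" if "ennreal r < extend F y" for y
    proof (rule ccontr)
      assume "\<not> ennreal (2 * \<theta>) < y"
      then have "extend F y \<le> extend F (ennreal (2 * \<theta>))"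
        by (intro extend_mono[OF Fm]) simp
      then show False
        using that \<theta> by simp
    qed
    have 2: "ennreal r \<le> ennreal K * extend F y" if "ennreal \<theta> \<le> y" for y
    proof -
      have "ennreal 2 * ennreal \<theta> \<le> ennreal 2 * y"
        using that by (rule mult_left_mono) simp
      moreover have "ennreal 2 * ennreal \<theta> = ennreal (2 * \<theta>)"
        using \<theta> by (simp add: ennreal_mult')
      ultimately have "extend F (ennreal (2 * \<theta>)) \<le> extend F (ennreal 2 * y)"
        using extend_mono[OF Fm] by metis
      also have "\<dots> \<le> ennreal K * extend F y"
        by (rule extend_scaling[OF F _ K]) simp
      finally show ?thesis
        using \<theta> by simp
    qed
    have 3: "ennreal r \<le> ennreal L * extend F y" if "\<not> y \<le> ennreal (\<delta> * \<theta>)" for y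
    proof -
      have "ennreal (2 / \<delta>) * ennreal (\<delta> * \<theta>) \<le> ennreal (2 / \<delta>) * y"
        using that by (intro mult_left_mono) simp_all
      moreover have "ennreal (2 / \<delta>) * ennreal (\<delta> * \<theta>) = ennreal (2 * \<theta>)"
        using \<theta> \<delta> by (simp add: ennreal_mult'[symmetric])
      ultimately have "extend F (ennreal (2 * \<theta>)) \<le> extend F (ennreal (2 / \<delta>) * y)"
        using extend_mono[OF Fm] by metis
      also have "\<dots> \<le> ennreal L * extend F y"
        by (rule extend_scaling[OF F _ L]) (use \<delta> in simp)
      finally show ?thesis
        using \<theta> by simp
    qed
    let ?G = "{\<omega>\<in>space M. ennreal (2 * \<theta>) < Y \<omega> \<and> X \<omega> \<le> ennreal (\<delta> * \<theta>)}"
    let ?H = "{\<omega>\<in>space M. ennreal \<theta> \<le> Y \<omega>}"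
    have "emeasure M {\<omega>\<in>space M. ennreal r < extend F (Y \<omega>)} \<le> emeasure M (?G \<union> ?C)"
      using 1 3 by (intro emeasure_mono) auto
    also have "\<dots> \<le> emeasure M ?G + emeasure M ?C"
      by (intro emeasure_subadditive) auto
    also have "emeasure M ?G \<le> ennreal \<epsilon> * emeasure M ?H"
      using good[OF \<theta>(1)] \<epsilon> by (simp add: emeasure_eq_measure ennreal_mult'[symmetric] ennreal_leI)
    also have "\<dots> \<le> ennreal \<epsilon> * emeasure M ?B"
      using 2 by (intro mult_left_mono emeasure_mono) auto
    finally show ?thesis
      by (simp add: add_right_mono)
  next
    case False
    have "extend F y \<le> ennreal r" for y
    proof (cases y)
      case (real a)
      then show ?thesis
        using False by (auto intro!: ennreal_leI simp: not_le dest!: spec[of _ a])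
    next
      case top
      then show ?thesis
        using False by (simp only: extend_def) (auto intro!: SUP_least ennreal_leI)
    qed
    then have *: "{\<omega>\<in>space M. ennreal r < extend F (Y \<omega>)} = {}"
      by (auto simp: not_less)
    show ?thesis
      unfolding * by simp
  qed
  \<comment> \<open>Absorbing a multiple of the left-hand side requires it to be finite, so the values of \<open>F (Y)\<close> are cut off at \<open>n\<close>.
     Since \<open>K \<ge> 1\<close>, the cut-off preserves the inequality \<open>min (K F (Y)) n \<le> K min (F (Y)) n\<close>.\<close>
  have trunc: "(\<integral>\<^sup>+\<omega>. min (extend F (Y \<omega>)) (ennreal n) \<partial>M)
      \<le> ennreal (2 * L) * (\<integral>\<^sup>+\<omega>. extend F (X \<omega>) \<partial>M)" if "0 < n" for n :: real
  proof -
    define A where "A = (\<integral>\<^sup>+\<omega>. min (extend F (Y \<omega>)) (ennreal n) \<partial>M)"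
    define Z where "Z = ennreal L * (\<integral>\<^sup>+\<omega>. extend F (X \<omega>) \<partial>M)"
    have "A = (\<integral>\<^sup>+r. emeasure M {\<omega>\<in>space M. ennreal r < extend F (Y \<omega>)} * indicator {0<..<n} r \<partial>lborel)"
      unfolding A_def by (rule nn_integral_min_layer_cake) (use that in auto)
    also have "\<dots> \<le> (\<integral>\<^sup>+r. ennreal \<epsilon> * (emeasure M {\<omega>\<in>space M. ennreal r \<le> ennreal K * extend F (Y \<omega>)} * indicator {0<..<n} r)
        + emeasure M {\<omega>\<in>space M. ennreal r \<le> ennreal L * extend F (X \<omega>)} * indicator {0<..<n} r \<partial>lborel)"
      using level by (intro nn_integral_mono) (auto simp: indicator_def)
    also have "\<dots> = ennreal \<epsilon> * (\<integral>\<^sup>+r. emeasure M {\<omega>\<in>space M. ennreal r \<le> ennreal K * extend F (Y \<omega>)} * indicator {0<..<n} r \<partial>lborel)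
        + (\<integral>\<^sup>+r. emeasure M {\<omega>\<in>space M. ennreal r \<le> ennreal L * extend F (X \<omega>)} * indicator {0<..<n} r \<partial>lborel)"
      by (subst nn_integral_add) (auto simp: nn_integral_cmult)
    also have "\<dots> = ennreal \<epsilon> * (\<integral>\<^sup>+\<omega>. min (ennreal K * extend F (Y \<omega>)) (ennreal n) \<partial>M)
        + (\<integral>\<^sup>+\<omega>. min (ennreal L * extend F (X \<omega>)) (ennreal n) \<partial>M)"
      by (subst (1 2) nn_integral_min_layer_cake(2)) (use that in auto)
    also have "\<dots> \<le> ennreal \<epsilon> * (ennreal K * A) + Z"
    proof (intro add_mono mult_left_mono)
      have "min (ennreal K * y) (ennreal n) \<le> ennreal K * min y (ennreal n)" for y
        using K(1) mult_right_mono[of 1 "ennreal K" "ennreal n"]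
        by (auto simp: min_def)
      then show "(\<integral>\<^sup>+\<omega>. min (ennreal K * extend F (Y \<omega>)) (ennreal n) \<partial>M) \<le> ennreal K * A"
        unfolding A_def by (subst nn_integral_cmult[symmetric]) (auto intro!: nn_integral_mono)
      show "(\<integral>\<^sup>+\<omega>. min (ennreal L * extend F (X \<omega>)) (ennreal n) \<partial>M) \<le> Z"
        unfolding Z_def by (subst nn_integral_cmult[symmetric]) (auto intro!: nn_integral_mono)
    qed simp
    also have "ennreal \<epsilon> * (ennreal K * A) = ennreal (\<epsilon> * K) * A"
      using \<epsilon> K by (simp add: ennreal_mult mult.assoc)
    also have "\<dots> \<le> ennreal (1 / 2) * A"
      using \<epsilon> by (intro mult_right_mono ennreal_leI) auto
    finally have AZ: "A \<le> ennreal (1 / 2) * A + Z"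
      by (simp add: add_right_mono)
    have "A \<le> (\<integral>\<^sup>+\<omega>. ennreal n \<partial>M)"
      unfolding A_def by (intro nn_integral_mono) simp
    then have "A \<le> ennreal n"
      by (simp add: emeasure_space_1)
    then obtain a where a: "A = ennreal a" "0 \<le> a"
      by (cases A) (auto simp: top_unique)
    have "A \<le> ennreal 2 * Z"
    proof (cases Z)
      case (real z)
      have "ennreal (1 / 2) * ennreal a + ennreal z = ennreal (1 / 2 * a) + ennreal z"
        using a by (subst ennreal_mult) auto
      also have "\<dots> = ennreal (1 / 2 * a + z)"
        using a real by (intro ennreal_plus[symmetric]) auto
      finally have "ennreal a \<le> ennreal (1 / 2 * a + z)"
        using AZ a real by metis
      then have "a \<le> 1 / 2 * a + z"
        using a real by (subst (asm) ennreal_le_iff) auto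
      then have "ennreal a \<le> ennreal (2 * z)"
        by (intro ennreal_leI) simp
      also have "\<dots> = ennreal 2 * ennreal z"
        using real by (intro ennreal_mult) auto
      finally show ?thesis
        using a real by simp
    next
      case top
      then show ?thesis by (simp add: ennreal_mult_top)
    qed
    also have "ennreal 2 * Z = ennreal (2 * L) * (\<integral>\<^sup>+\<omega>. extend F (X \<omega>) \<partial>M)"
      unfolding Z_def using L by (simp add: ennreal_mult mult.assoc)
    finally show ?thesis
      unfolding A_def .
  qed
  have "(\<integral>\<^sup>+\<omega>. extend F (Y \<omega>) \<partial>M) = (\<integral>\<^sup>+\<omega>. (SUP n::nat. min (extend F (Y \<omega>)) (ennreal (real n + 1))) \<partial>M)"
  proof (intro nn_integral_cong)
    fix \<omega>
    have "(SUP n::nat. min y (ennreal (real n + 1))) = y" for y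
    proof (rule antisym)
      show "y \<le> (SUP n::nat. min y (ennreal (real n + 1)))"
      proof (cases y)
        case (real a)
        obtain n :: nat where "a \<le> real n"
          using real_arch_simple by blast
        then show ?thesis
          using real by (intro SUP_upper2[of n]) (auto intro!: ennreal_leI simp del: ennreal_plus)
      next
        case top
        have "(SUP n::nat. of_nat n :: ennreal) \<le> (SUP n::nat. min y (ennreal (real n + 1)))"
          using top by (intro SUP_mono')
            (simp add: ennreal_of_nat_eq_real_of_nat ennreal_leI del: ennreal_plus)
        then show ?thesis
          using top by (simp add: ennreal_SUP_of_nat_eq_top top_unique)
      qed
    qed (auto intro: SUP_least)
    then show "extend F (Y \<omega>) = (SUP n::nat. min (extend F (Y \<omega>)) (ennreal (real n + 1)))"
      by simp
  qed
  also have "\<dots> = (SUP n::nat. (\<integral>\<^sup>+\<omega>. min (extend F (Y \<omega>)) (ennreal (real n + 1)) \<partial>M))"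
  proof (rule nn_integral_monotone_convergence_SUP)
    show "incseq (\<lambda>n \<omega>. min (extend F (Y \<omega>)) (ennreal (real n + 1)))"
      unfolding incseq_def le_fun_def by (intro allI impI min.mono order_refl ennreal_leI) simp
  qed measurable
  also have "\<dots> \<le> ennreal (2 * L) * (\<integral>\<^sup>+\<omega>. extend F (X \<omega>) \<partial>M)"
    by (intro SUP_least trunc) simp
  finally show ?thesis .
qed

lemma (in prob_space) good_lambda_moderate:
  assumes F: "moderate F" and good: "good_lambda M I Y X"
    and meas: "\<And>i. i \<in> I \<Longrightarrow> X i \<in> borel_measurable M" "\<And>i. i \<in> I \<Longrightarrow> Y i \<in> borel_measurable M"
  shows "\<exists>C>0. \<forall>i\<in>I. (\<integral>\<^sup>+\<omega>. extend F (Y i \<omega>) \<partial>M) \<le> ennreal C * (\<integral>\<^sup>+\<omega>. extend F (X i \<omega>) \<partial>M)"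
proof -
  obtain K where K: "1 \<le> K" "\<forall>x\<ge>0. F (2 * x) \<le> K * F x"
    using moderate_scaling[OF F, of 2] by auto
  then have "1 / (2 * K) > 0" by simp
  with good obtain \<delta> where \<delta>: "\<delta> > 0" and gl: "\<forall>i\<in>I. \<forall>\<theta>>0.
     measure M {\<omega>\<in>space M. ennreal (2 * \<theta>) < Y i \<omega> \<and> X i \<omega> \<le> ennreal (\<delta> * \<theta>)}
       \<le> (1 / (2 * K)) * measure M {\<omega>\<in>space M. ennreal \<theta> \<le> Y i \<omega>}"
    unfolding good_lambda_def by blast
  obtain L where L: "1 \<le> L" "\<forall>x\<ge>0. F (2 / \<delta> * x) \<le> L * F x"
    using moderate_scaling[OF F, of "2 / \<delta>"] \<delta> by auto
  have "(\<integral>\<^sup>+\<omega>. extend F (Y i \<omega>) \<partial>M) \<le> ennreal (2 * L) * (\<integral>\<^sup>+\<omega>. extend F (X i \<omega>) \<partial>M)" if "i \<in> I" for i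
    by (rule good_lambda_integral[OF F K L \<delta>, where \<epsilon> = "1 / (2 * K)"])
       (use that gl K meas in auto)
  with L show ?thesis
    by (intro exI[of _ "2 * L"]) auto
qed

section \<open>Gaussian estimates\<close>

lemma (in prob_space) normal_prob_eq:
  assumes "distributed M lborel D (normal_density 0 \<sigma>)" and [measurable]: "A \<in> sets borel"
  shows "ennreal (prob {\<omega>\<in>space M. D \<omega> \<in> A}) = (\<integral>\<^sup>+x. ennreal (normal_density 0 \<sigma> x) * indicator A x \<partial>lborel)"
proof -
  have "{\<omega>\<in>space M. D \<omega> \<in> A} = D -` A \<inter> space M" by auto
  then show ?thesis
    using distributed_emeasure[OF assms(1), of A] by (simp add: emeasure_eq_measure)
qed

text \<open>
  For \<open>\<bar>z\<bar> \<ge> x\<close>, the density is at most \<open>sqrt 2 exp (- x\<^sup>2 / (4 \<sigma>\<^sup>2))\<close> times the density with variance \<open>2 \<sigma>\<^sup>2\<close>.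
\<close>

lemma (in prob_space) normal_tail:
  assumes D: "distributed M lborel D (normal_density 0 \<sigma>)" and \<sigma>: "0 < \<sigma>" and x: "0 \<le> x"
  shows "prob {\<omega>\<in>space M. x \<le> \<bar>D \<omega>\<bar>} \<le> sqrt 2 * exp (- x\<^sup>2 / (4 * \<sigma>\<^sup>2))"
proof -
  have [measurable]: "{z::real. x \<le> \<bar>z\<bar>} \<in> sets borel" by measurable
  have pt: "normal_density 0 \<sigma> z \<le> sqrt 2 * exp (- x\<^sup>2 / (4 * \<sigma>\<^sup>2)) * normal_density 0 (sqrt 2 * \<sigma>) z"
    if "x \<le> \<bar>z\<bar>" for z
  proof -
    have "x\<^sup>2 \<le> z\<^sup>2"
      using that x power_mono[of x "\<bar>z\<bar>" 2] by simp
    then have "exp (- z\<^sup>2 / (2 * \<sigma>\<^sup>2)) \<le> exp (- x\<^sup>2 / (4 * \<sigma>\<^sup>2) + (- z\<^sup>2 / (2 * (sqrt 2 * \<sigma>)\<^sup>2)))"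
      using \<sigma> by (simp add: power_mult_distrib field_simps)
    moreover have "1 / sqrt (2 * pi * \<sigma>\<^sup>2) = sqrt 2 * (1 / sqrt (2 * pi * (sqrt 2 * \<sigma>)\<^sup>2))"
      using \<sigma> by (simp add: power_mult_distrib real_sqrt_mult field_simps)
    ultimately show ?thesis
      unfolding normal_density_def exp_add
      by (simp add: mult_left_mono mult.assoc divide_right_mono mult.left_commute)
  qed
  have "ennreal (prob {\<omega>\<in>space M. D \<omega> \<in> {z. x \<le> \<bar>z\<bar>}})
      \<le> (\<integral>\<^sup>+z. ennreal (sqrt 2 * exp (- x\<^sup>2 / (4 * \<sigma>\<^sup>2))) * ennreal (normal_density 0 (sqrt 2 * \<sigma>) z) \<partial>lborel)"
    unfolding normal_prob_eq[OF D \<open>{z. x \<le> \<bar>z\<bar>} \<in> sets borel\<close>]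
    using pt by (intro nn_integral_mono) (auto simp: indicator_def ennreal_mult'[symmetric] intro!: ennreal_leI)
  also have "\<dots> = ennreal (sqrt 2 * exp (- x\<^sup>2 / (4 * \<sigma>\<^sup>2)))"
    using \<sigma> by (simp add: nn_integral_cmult nn_integral_eq_integral)
  finally show ?thesis
    by (simp add: ennreal_le_iff)
qed

lemma (in prob_space) normal_small_ball:
  assumes D: "distributed M lborel D (normal_density 0 \<sigma>)" and \<sigma>: "0 < \<sigma>" and x: "0 \<le> x"
  shows "prob {\<omega>\<in>space M. \<bar>D \<omega>\<bar> \<le> x} \<le> x / \<sigma>"
proof -
  have pt: "normal_density 0 \<sigma> z \<le> 1 / (2 * \<sigma>)" for z
  proof -
    have "sqrt 4 \<le> sqrt (2 * pi)"
      using pi_gt3 by (intro real_sqrt_le_mono) simp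
    then have "2 * \<sigma> \<le> sqrt (2 * pi) * \<sigma>"
      using \<sigma> by (intro mult_right_mono) auto
    then have "1 / sqrt (2 * pi * \<sigma>\<^sup>2) \<le> 1 / (2 * \<sigma>)"
      using \<sigma> by (simp add: real_sqrt_mult frac_le)
    moreover have "exp (- (z - 0)\<^sup>2 / (2 * \<sigma>\<^sup>2)) \<le> 1"
      by simp
    ultimately have "1 / sqrt (2 * pi * \<sigma>\<^sup>2) * exp (- (z - 0)\<^sup>2 / (2 * \<sigma>\<^sup>2)) \<le> 1 / (2 * \<sigma>) * 1"
      using \<sigma> by (intro mult_mono) auto
    then show ?thesis
      by (simp add: normal_density_def)
  qed
  have "ennreal (prob {\<omega>\<in>space M. D \<omega> \<in> {-x..x}}) \<le> (\<integral>\<^sup>+z. ennreal (1 / (2 * \<sigma>)) * indicator {-x..x} z \<partial>lborel)"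
    by (subst normal_prob_eq[OF D]) (auto intro!: nn_integral_mono mult_right_mono ennreal_leI pt)
  also have "\<dots> = ennreal (x / \<sigma>)"
    using x \<sigma> by (simp add: nn_integral_cmult_indicator ennreal_mult'[symmetric])
  finally have "prob {\<omega>\<in>space M. D \<omega> \<in> {-x..x}} \<le> x / \<sigma>"
    using x \<sigma> by (simp add: ennreal_le_iff)
  also have "{\<omega>\<in>space M. D \<omega> \<in> {-x..x}} = {\<omega>\<in>space M. \<bar>D \<omega>\<bar> \<le> x}"
    by auto
  finally show ?thesis .
qed

text \<open>
  The mass that is missing from \<open>\<bar>D\<bar> \<le> y \<sigma>\<close> is at least that of the interval from \<open>y \<sigma>\<close> to \<open>(y + 1) \<sigma>\<close>,
  on which the density decreases.
\<close>

lemma (in prob_space) normal_not_small: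
  assumes D: "distributed M lborel D (normal_density 0 \<sigma>)" and \<sigma>: "0 < \<sigma>" and y: "0 \<le> y"
  shows "prob {\<omega>\<in>space M. \<bar>D \<omega>\<bar> \<le> y * \<sigma>} \<le> 1 - std_normal_density (y + 1)"
proof -
  have [measurable]: "D \<in> borel_measurable M"
    using distributed_measurable[OF D] by simp
  let ?I = "{y * \<sigma><..(y + 1) * \<sigma>}"
  have pt: "std_normal_density (y + 1) / \<sigma> \<le> normal_density 0 \<sigma> z" if "z \<in> ?I" for z
  proof -
    have "0 \<le> z" "z \<le> (y + 1) * \<sigma>"
      using that y \<sigma> by (auto intro: order_trans[of _ "y * \<sigma>"])
    then have "z\<^sup>2 \<le> ((y + 1) * \<sigma>)\<^sup>2"
      by (intro power_mono)
    then have "z\<^sup>2 / (2 * \<sigma>\<^sup>2) \<le> ((y + 1) * \<sigma>)\<^sup>2 / (2 * \<sigma>\<^sup>2)"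
      by (intro divide_right_mono) auto
    also have "\<dots> = (y + 1)\<^sup>2 / 2"
      using \<sigma> by (simp add: power_mult_distrib)
    finally have "z\<^sup>2 / (2 * \<sigma>\<^sup>2) \<le> (y + 1)\<^sup>2 / 2" .
    then have "exp (- (y + 1)\<^sup>2 / 2) \<le> exp (- z\<^sup>2 / (2 * \<sigma>\<^sup>2))"
      by simp
    then show ?thesis
      using \<sigma> by (simp add: normal_density_def real_sqrt_mult divide_simps mult_left_mono)
  qed
  have "ennreal (std_normal_density (y + 1)) = (\<integral>\<^sup>+z. ennreal (std_normal_density (y + 1) / \<sigma>) * indicator ?I z \<partial>lborel)"
    using y \<sigma> by (simp add: nn_integral_cmult_indicator ennreal_mult'[symmetric] algebra_simps)
  also have "\<dots> \<le> ennreal (prob {\<omega>\<in>space M. D \<omega> \<in> ?I})"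
    by (subst normal_prob_eq[OF D]) (auto intro!: nn_integral_mono ennreal_leI pt simp: indicator_def)
  finally have "std_normal_density (y + 1) \<le> prob {\<omega>\<in>space M. D \<omega> \<in> ?I}"
    by (simp add: ennreal_le_iff)
  also have "\<dots> \<le> prob (space M - {\<omega>\<in>space M. \<bar>D \<omega>\<bar> \<le> y * \<sigma>})"
    by (intro finite_measure_mono) auto
  also have "\<dots> = 1 - prob {\<omega>\<in>space M. \<bar>D \<omega>\<bar> \<le> y * \<sigma>}"
    by (intro prob_compl) auto
  finally show ?thesis by simp
qed

section \<open>Running maxima of continuous processes\<close>

lemma running_max_mono:
  assumes "\<And>t. 0 \<le> t \<Longrightarrow> g t \<le> h t"
  shows "running_max g \<tau> \<le> running_max h \<tau>"
  unfolding running_max_def using assms by (intro SUP_mono) (auto intro!: ennreal_leI)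

lemma less_running_max_iff:
  assumes "0 \<le> c"
  shows "ennreal c < running_max g \<tau> \<longleftrightarrow> (\<exists>t\<ge>0. ennreal t \<le> \<tau> \<and> c < g t)"
  unfolding running_max_def less_SUP_iff using assms by (auto simp: ennreal_less_iff)

lemma le_running_max:
  assumes "0 \<le> t" "ennreal t \<le> \<tau>"
  shows "ennreal (g t) \<le> running_max g \<tau>"
  unfolding running_max_def using assms by (intro SUP_upper) auto

text \<open>
  By continuity, a value above \<open>c\<close> at time \<open>t\<close> persists slightly earlier, hence at a time of a dense set that
  does not exceed the random bound \<open>\<tau>\<close>.  The point \<open>0\<close> has to belong to the dense set because of \<open>t = 0\<close>.
\<close>

lemma dense_time_below:
  fixes g :: "real \<Rightarrow> real"
  assumes g: "continuous_on {0..} g" and t: "0 \<le> t" "ennreal t \<le> \<tau>" "c < g t"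
    and Q: "0 \<in> Q" "\<And>x y. 0 \<le> x \<Longrightarrow> x < y \<Longrightarrow> y \<le> t \<Longrightarrow> \<exists>q\<in>Q. x < q \<and> q < y"
  shows "\<exists>q\<in>Q. 0 \<le> q \<and> q \<le> t \<and> ennreal q \<le> \<tau> \<and> c < g q"
proof (cases "t = 0")
  case True
  then show ?thesis using Q t by auto
next
  case False
  have "isCont g t"
    using continuous_on_interior[OF g] False t by simp
  then have "(g \<longlongrightarrow> g t) (at t)"
    by (simp add: isCont_def)
  then have "eventually (\<lambda>s. c < g s) (at t)"
    using t by (intro order_tendstoD)
  then obtain d where d: "d > 0" "\<And>s. s \<noteq> t \<Longrightarrow> dist s t < d \<Longrightarrow> c < g s"
    by (auto simp: eventually_at)
  obtain q where q: "q \<in> Q" "max 0 (t - d) < q" "q < t"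
    using Q(2)[of "max 0 (t - d)" t] d t False by auto
  then have "c < g q"
    using d by (auto simp: dist_real_def)
  moreover have "ennreal q \<le> \<tau>"
    using q by (intro order_trans[OF _ t(2)] ennreal_leI) auto
  ultimately show ?thesis
    using q by (intro bexI[of _ q]) simp_all
qed

lemma (in complete_measure) borel_measurable_AE_eq:
  fixes f g :: "'a \<Rightarrow> ennreal"
  assumes g: "g \<in> borel_measurable M" and eq: "AE \<omega> in M. f \<omega> = g \<omega>"
  shows "f \<in> borel_measurable M"
proof (rule measurableI)
  fix A :: "ennreal set" assume "A \<in> sets borel"
  then have "g -` A \<inter> space M \<in> sets M"
    by (rule measurable_sets[OF g])
  moreover have "AE \<omega> in M. \<omega> \<in> g -` A \<inter> space M \<longleftrightarrow> \<omega> \<in> f -` A \<inter> space M"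
    using eq by eventually_elim simp
  ultimately show "f -` A \<inter> space M \<in> sets M"
    using in_sets_AE by blast
qed simp

text \<open>
  The supremum over all times agrees with the supremum over rational times on the paths that are continuous;
  completeness turns this almost sure identity into measurability.
\<close>

lemma (in complete_measure) borel_measurable_running_max:
  fixes h :: "real \<Rightarrow> 'a \<Rightarrow> real"
  assumes [measurable]: "\<tau> \<in> borel_measurable M"
    and h: "\<And>t. 0 \<le> t \<Longrightarrow> h t \<in> borel_measurable M"
    and cont: "AE \<omega> in M. continuous_on {0..} (\<lambda>t. h t \<omega>)"
  shows "(\<lambda>\<omega>. running_max (\<lambda>t. h t \<omega>) (\<tau> \<omega>)) \<in> borel_measurable M"
proof (rule borel_measurable_AE_eq)
  let ?Q = "{q\<in>\<rat>. (0::real) \<le> q}"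
  let ?g = "\<lambda>\<omega>. SUP q\<in>?Q. if ennreal q \<le> \<tau> \<omega> then ennreal (h q \<omega>) else 0"
  have "countable ?Q"
    using countable_rat by (rule countable_subset[rotated]) auto
  then show "?g \<in> borel_measurable M"
  proof (rule borel_measurable_SUP)
    fix q assume "q \<in> ?Q"
    then have [measurable]: "h q \<in> borel_measurable M"
      using h by simp
    show "(\<lambda>\<omega>. if ennreal q \<le> \<tau> \<omega> then ennreal (h q \<omega>) else 0) \<in> borel_measurable M"
      by measurable
  qed
  show "AE \<omega> in M. running_max (\<lambda>t. h t \<omega>) (\<tau> \<omega>) = ?g \<omega>"
    using cont
  proof eventually_elim
    case (elim \<omega>)
    show ?case
    proof (rule antisym)
      show "running_max (\<lambda>t. h t \<omega>) (\<tau> \<omega>) \<le> ?g \<omega>"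
      proof (rule le_SUP_iff[THEN iffD2], intro allI impI)
        fix y assume y: "y < running_max (\<lambda>t. h t \<omega>) (\<tau> \<omega>)"
        then have "y \<noteq> \<top>"
          by auto
        then obtain c where c: "0 \<le> c" "y = ennreal c"
          by (cases y) auto
        have "\<exists>t\<ge>0. ennreal t \<le> \<tau> \<omega> \<and> c < h t \<omega>"
          using y c less_running_max_iff[OF c(1)] by simp
        then obtain t where t: "0 \<le> t" "ennreal t \<le> \<tau> \<omega>" "c < h t \<omega>"
          by blast
        have "\<exists>q\<in>?Q. 0 \<le> q \<and> q \<le> t \<and> ennreal q \<le> \<tau> \<omega> \<and> c < h q \<omega>"
          using elim t
        proof (rule dense_time_below)
          fix x y :: real assume "0 \<le> x" "x < y"
          then show "\<exists>q\<in>?Q. x < q \<and> q < y"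
            using Rats_dense_in_real[of x y] by auto
        qed simp
        then show "\<exists>q\<in>?Q. y < (if ennreal q \<le> \<tau> \<omega> then ennreal (h q \<omega>) else 0)"
          using c by (auto simp: ennreal_less_iff)
      qed
      show "?g \<omega> \<le> running_max (\<lambda>t. h t \<omega>) (\<tau> \<omega>)"
        by (intro SUP_least) (auto intro: le_running_max)
    qed
  qed
qed

section \<open>Increments of a Brownian motion\<close>

locale filtered_BM = prob_space M + complete_measure M for M :: "'a measure" +
  fixes \<F> :: "ennreal \<Rightarrow> 'a measure" and B :: "real \<Rightarrow> 'a \<Rightarrow> real"
  assumes BM: "standard_BM M \<F> B"
    and sub: "subalgebra M (\<F> t)"
    and filt: "filtration (space M) \<F>"
begin

lemma space_F [simp]: "space (\<F> t) = space M"
  using sub[of t] by (simp add: subalgebra_def)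

lemma sets_F_events: "E \<in> sets (\<F> t) \<Longrightarrow> E \<in> events"
  using sub[of t] by (auto simp: subalgebra_def)

lemma sets_F_mono: "s \<le> t \<Longrightarrow> E \<in> sets (\<F> s) \<Longrightarrow> E \<in> sets (\<F> t)"
  using filtration.sets_F_mono[OF filt] by blast

lemma adapted:
  assumes "0 \<le> s" "s \<le> t"
  shows "B s \<in> borel_measurable (\<F> (ennreal t))"
proof (rule measurable_from_subalg)
  show "subalgebra (\<F> (ennreal t)) (\<F> (ennreal s))"
    using sets_F_mono[OF ennreal_leI[OF assms(2)]] by (auto simp: subalgebra_def)
  show "B s \<in> borel_measurable (\<F> (ennreal s))"
    using BM assms unfolding standard_BM_def by blast
qed

lemma B_measurable: "0 \<le> t \<Longrightarrow> B t \<in> borel_measurable M"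
  by (rule measurable_from_subalg[OF sub adapted[OF _ order_refl]])

lemma B_0: "AE \<omega> in M. B 0 \<omega> = 0"
  and B_continuous: "AE \<omega> in M. continuous_on {0..} (\<lambda>t. B t \<omega>)"
  using BM unfolding standard_BM_def by blast+

lemma increment_normal:
  "0 \<le> s \<Longrightarrow> s < t \<Longrightarrow> distributed M lborel (\<lambda>\<omega>. B t \<omega> - B s \<omega>) (normal_density 0 (sqrt (t - s)))"
  using BM unfolding standard_BM_def by blast

lemma increment_indep:
  assumes "0 \<le> s" "s < t" and E: "E \<in> sets (\<F> (ennreal s))" and A: "A \<in> sets borel"
  shows "prob (E \<inter> {\<omega>\<in>space M. B t \<omega> - B s \<omega> \<in> A}) = prob E * prob {\<omega>\<in>space M. B t \<omega> - B s \<omega> \<in> A}"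
proof (rule indep_setD)
  show "indep_set (sets (\<F> (ennreal s))) (sets (vimage_algebra (space M) (\<lambda>\<omega>. B t \<omega> - B s \<omega>) borel))"
    using BM assms unfolding standard_BM_def by blast
  have "{\<omega>\<in>space M. B t \<omega> - B s \<omega> \<in> A} = (\<lambda>\<omega>. B t \<omega> - B s \<omega>) -` A \<inter> space M"
    by auto
  also have "\<dots> \<in> sets (vimage_algebra (space M) (\<lambda>\<omega>. B t \<omega> - B s \<omega>) borel)"
    using A by (rule in_vimage_algebra)
  finally show "{\<omega>\<in>space M. B t \<omega> - B s \<omega> \<in> A} \<in> sets (vimage_algebra (space M) (\<lambda>\<omega>. B t \<omega> - B s \<omega>) borel)" .
qed (fact E)

lemma increment_tail:
  assumes "0 \<le> s" "s < t" "t - s \<le> v" "0 \<le> x"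
  shows "prob {\<omega>\<in>space M. x \<le> \<bar>B t \<omega> - B s \<omega>\<bar>} \<le> sqrt 2 * exp (- x\<^sup>2 / (4 * v))"
proof -
  have "prob {\<omega>\<in>space M. x \<le> \<bar>B t \<omega> - B s \<omega>\<bar>} \<le> sqrt 2 * exp (- x\<^sup>2 / (4 * (sqrt (t - s))\<^sup>2))"
    using assms by (intro normal_tail increment_normal) auto
  also have "\<dots> \<le> sqrt 2 * exp (- x\<^sup>2 / (4 * v))"
    using assms by (intro mult_left_mono) (auto intro!: divide_left_mono mult_pos_pos)
  finally show ?thesis .
qed

text \<open>
  Ottaviani's inequality, relative to an event \<open>E\<close> of the past.  At the first time \<open>t\<close> of \<open>D\<close> at which the
  increment since \<open>a\<close> is at least \<open>2 x\<close>, the future increment up to \<open>b\<close> is independent of the past and with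
  probability at least \<open>1 / 2\<close> smaller than \<open>x\<close>; then the whole increment from \<open>a\<close> to \<open>b\<close> exceeds \<open>x\<close>.
  Independence is applied to one increment at a time.
\<close>

lemma window_maximal_inequality:
  assumes ab: "0 \<le> a" "a < b" and E: "E \<in> sets (\<F> (ennreal a))"
    and D: "finite D" "D \<subseteq> {a..b}" and x: "0 \<le> x"
  shows "prob (E \<inter> {\<omega>\<in>space M. \<exists>t\<in>D. 2 * x \<le> \<bar>B t \<omega> - B a \<omega>\<bar>})
    \<le> 2 * sqrt 2 * exp (- x\<^sup>2 / (4 * (b - a))) * prob E"
proof -
  \<comment> \<open>If the Gaussian bound \<open>q\<close> exceeds \<open>1 / 2\<close>, then the claim is trivial; otherwise \<open>q\<close> controls every future increment.\<close>
  define q where "q = sqrt 2 * exp (- x\<^sup>2 / (4 * (b - a)))"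
  have [measurable]: "E \<in> events"
    using E by (rule sets_F_events)
  have BD: "B t \<in> borel_measurable M" if "t \<in> D" for t
    using that D ab by (intro B_measurable) auto
  have [measurable]: "B a \<in> borel_measurable M" "B b \<in> borel_measurable M"
    using ab by (auto intro!: B_measurable)
  let ?S = "E \<inter> {\<omega>\<in>space M. \<exists>t\<in>D. 2 * x \<le> \<bar>B t \<omega> - B a \<omega>\<bar>}"
  have "prob ?S \<le> 2 * q * prob E"
  proof (cases "q \<le> 1 / 2")
    case False
    have "prob ?S \<le> prob E"
      by (intro finite_measure_mono) auto
    also have "\<dots> \<le> 2 * q * prob E"
      using False mult_right_mono[of 1 "2 * q" "prob E"] by auto
    finally show ?thesis .
  next
    case True
    have "x \<noteq> 0"
    proof
      assume "x = 0"
      then have "q = sqrt 2"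
        by (simp add: q_def)
      moreover have "1 \<le> sqrt (2::real)"
        by simp
      ultimately show False
        using True by linarith
    qed
    \<comment> \<open>\<open>A t\<close>: the first exceedance is at \<open>t\<close>; \<open>C t\<close>: the increment after \<open>t\<close> is small.\<close>
    define A where "A t = E \<inter> {\<omega>\<in>space M. 2 * x \<le> \<bar>B t \<omega> - B a \<omega>\<bar> \<and> (\<forall>s\<in>D. s < t \<longrightarrow> \<bar>B s \<omega> - B a \<omega>\<bar> < 2 * x)}" for t
    define C where "C t = {\<omega>\<in>space M. \<bar>B b \<omega> - B t \<omega>\<bar> < x}" for t
    have A_F: "A t \<in> sets (\<F> (ennreal t))" if "t \<in> D" for t
    proof -
      have t: "a \<le> t" "0 \<le> t"
        using that D ab by auto
      have [measurable]: "E \<in> sets (\<F> (ennreal t))"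
        using t by (intro sets_F_mono[OF _ E] ennreal_leI)
      have [measurable]: "B t \<in> borel_measurable (\<F> (ennreal t))" "B a \<in> borel_measurable (\<F> (ennreal t))"
        using t ab by (auto intro!: adapted)
      have Bs: "{\<omega>\<in>space (\<F> (ennreal t)). \<bar>B s \<omega> - B a \<omega>\<bar> < 2 * x} \<in> sets (\<F> (ennreal t))"
        if "s \<in> {s\<in>D. s < t}" for s
      proof -
        have [measurable]: "B s \<in> borel_measurable (\<F> (ennreal t))"
          using that D ab by (intro adapted) auto
        show ?thesis by measurable
      qed
      have fin: "finite {s\<in>D. s < t}"
        using D by simp
      have "{\<omega>\<in>space (\<F> (ennreal t)). 2 * x \<le> \<bar>B t \<omega> - B a \<omega>\<bar>} \<in> sets (\<F> (ennreal t))"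
        by measurable
      moreover have "{\<omega>\<in>space (\<F> (ennreal t)). \<forall>s\<in>{s\<in>D. s < t}. \<bar>B s \<omega> - B a \<omega>\<bar> < 2 * x} \<in> sets (\<F> (ennreal t))"
        by (intro sets.sets_Collect_finite_All fin Bs)
      moreover have "A t = E \<inter> {\<omega>\<in>space (\<F> (ennreal t)). 2 * x \<le> \<bar>B t \<omega> - B a \<omega>\<bar>}
          \<inter> {\<omega>\<in>space (\<F> (ennreal t)). \<forall>s\<in>{s\<in>D. s < t}. \<bar>B s \<omega> - B a \<omega>\<bar> < 2 * x}"
        by (auto simp: A_def)
      ultimately show ?thesis by auto
    qed
    have A: "A t \<in> events" if "t \<in> D" for t
      using A_F[OF that] by (rule sets_F_events)
    have C: "C t \<in> events" if "t \<in> D" for t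
    proof -
      have [measurable]: "B t \<in> borel_measurable M"
        using that by (rule BD)
      show ?thesis unfolding C_def by measurable
    qed
    have cover: "?S \<subseteq> (\<Union>t\<in>D. A t)"
    proof
      fix \<omega> assume \<omega>: "\<omega> \<in> ?S"
      let ?H = "{t\<in>D. 2 * x \<le> \<bar>B t \<omega> - B a \<omega>\<bar>}"
      have H: "finite ?H" "?H \<noteq> {}"
        using D \<omega> by auto
      have "Min ?H \<in> ?H"
        using H by (rule Min_in)
      moreover have "\<bar>B s \<omega> - B a \<omega>\<bar> < 2 * x" if "s \<in> D" "s < Min ?H" for s
        using that Min_le[OF H(1), of s] by fastforce
      ultimately show "\<omega> \<in> (\<Union>t\<in>D. A t)"
        using \<omega> by (auto simp: A_def)
    qed
    have half: "prob (A t) \<le> 2 * prob (A t \<inter> C t)" if "t \<in> D" for t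
    proof (cases "t = b")
      case True
      have "A t \<inter> C t = A t"
        using True x \<open>x \<noteq> 0\<close> by (auto simp: C_def A_def)
      then show ?thesis by simp
    next
      case False
      then have t: "0 \<le> t" "t < b" "a \<le> t"
        using that D ab by auto
      have [measurable]: "B t \<in> borel_measurable M"
        using that by (rule BD)
      have "prob (space M - {\<omega>\<in>space M. x \<le> \<bar>B b \<omega> - B t \<omega>\<bar>}) = 1 - prob {\<omega>\<in>space M. x \<le> \<bar>B b \<omega> - B t \<omega>\<bar>}"
        by (intro prob_compl) measurable
      also have "space M - {\<omega>\<in>space M. x \<le> \<bar>B b \<omega> - B t \<omega>\<bar>} = C t"
        by (auto simp: C_def)
      finally have "prob (C t) = 1 - prob {\<omega>\<in>space M. x \<le> \<bar>B b \<omega> - B t \<omega>\<bar>}" .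
      moreover have "prob {\<omega>\<in>space M. x \<le> \<bar>B b \<omega> - B t \<omega>\<bar>} \<le> q"
        unfolding q_def using t x by (intro increment_tail) auto
      ultimately have "1 / 2 \<le> prob (C t)"
        using True by simp
      then have "prob (A t) * 1 \<le> prob (A t) * (2 * prob (C t))"
        by (intro mult_left_mono) auto
      also have "prob (A t) * (2 * prob (C t)) = 2 * prob (A t \<inter> C t)"
      proof -
        have "C t = {\<omega>\<in>space M. B b \<omega> - B t \<omega> \<in> {-x<..<x}}"
          by (auto simp: C_def)
        then show ?thesis
          using increment_indep[OF t(1,2) A_F[OF that], of "{-x<..<x}"] by (simp only: borel_open open_greaterThanLessThan)
      qed
      finally show ?thesis by simp
    qed
    have "prob ?S \<le> prob (\<Union>t\<in>D. A t)"
      using D cover A by (intro finite_measure_mono sets.finite_UN) auto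
    also have "\<dots> \<le> (\<Sum>t\<in>D. prob (A t))"
      using D A by (intro finite_measure_subadditive_finite) auto
    also have "\<dots> \<le> (\<Sum>t\<in>D. 2 * prob (A t \<inter> C t))"
      by (intro sum_mono half)
    also have "\<dots> = 2 * (\<Sum>t\<in>D. prob (A t \<inter> C t))"
      by (simp add: sum_distrib_left)
    also have "(\<Sum>t\<in>D. prob (A t \<inter> C t)) = prob (\<Union>t\<in>D. A t \<inter> C t)"
    proof (rule finite_measure_finite_Union[symmetric])
      show "disjoint_family_on (\<lambda>t. A t \<inter> C t) D"
        unfolding disjoint_family_on_def
      proof (intro ballI impI)
        fix s t assume st: "s \<in> D" "t \<in> D" "s \<noteq> t"
        then have "A s \<inter> A t = {}"
          by (cases s t rule: linorder_cases) (auto simp: A_def)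
        then show "(A s \<inter> C s) \<inter> (A t \<inter> C t) = {}"
          by auto
      qed
    qed (use D A C in auto)
    also have "\<dots> \<le> prob (E \<inter> {\<omega>\<in>space M. B b \<omega> - B a \<omega> \<in> {z. x \<le> \<bar>z\<bar>}})"
      by (intro finite_measure_mono) (auto simp: A_def C_def)
    also have "\<dots> = prob E * prob {\<omega>\<in>space M. B b \<omega> - B a \<omega> \<in> {z. x \<le> \<bar>z\<bar>}}"
      by (rule increment_indep[OF ab E]) simp
    also have "\<dots> \<le> prob E * q"
      unfolding q_def using increment_tail[OF ab order_refl x] by (intro mult_left_mono) auto
    finally show ?thesis
      by (simp add: mult_ac)
  qed
  then show ?thesis
    by (simp add: q_def mult.assoc)
qed

lemma window_event:
  assumes "0 \<le> a" "E \<in> sets (\<F> (ennreal a))" "finite D" "D \<subseteq> {0..}"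
  shows "E \<inter> {\<omega>\<in>space M. \<exists>t\<in>D. c t \<le> \<bar>B t \<omega> - B a \<omega>\<bar>} \<in> events"
proof -
  have "{\<omega>\<in>space M. c t \<le> \<bar>B t \<omega> - B a \<omega>\<bar>} \<in> events" if "t \<in> D" for t
  proof -
    have [measurable]: "B t \<in> borel_measurable M" "B a \<in> borel_measurable M"
      using that assms by (auto intro!: B_measurable)
    show ?thesis by measurable
  qed
  then show ?thesis
    using assms by (intro sets.Int sets.sets_Collect_finite_Ex sets_F_events[OF assms(2)]) auto
qed

text \<open>
  The window is cut into scales \<open>4 ^ j \<le> 1 + (t - a) < 4 ^ (j + 1)\<close>.  On each of them the weight
  \<open>sqrt (1 + t)\<close> is at least \<open>2 ^ j\<close> and the standard deviation of the increment at most \<open>2 ^ (j + 1)\<close>, so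
  that all scales contribute the same Gaussian bound.  At most \<open>1 + ln (1 + u)\<close> scales are needed.
\<close>

lemma weighted_window_maximal_inequality:
  assumes a: "0 \<le> a" "a \<le> u" and E: "E \<in> sets (\<F> (ennreal a))"
    and D: "finite D" "D \<subseteq> {a..u}" and y: "0 \<le> y"
  shows "prob (E \<inter> {\<omega>\<in>space M. \<exists>t\<in>D. y * sqrt (1 + t) \<le> \<bar>B t \<omega> - B a \<omega>\<bar>})
    \<le> (1 + ln (1 + u)) * (2 * sqrt 2 * exp (- y\<^sup>2 / 64)) * prob E"
proof -
  define N where "N = nat \<lfloor>ln (1 + u)\<rfloor> + 1"
  have N: "real N \<le> 1 + ln (1 + u)" "ln (1 + u) < real N"
    using a by (auto simp: N_def) linarith+
  have "exp (1 * real N) = exp 1 ^ N"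
    by (rule exp_of_nat2_mult)
  also have "exp (1::real) ^ N \<le> 4 ^ N"
  proof (rule power_mono)
    show "exp (1::real) \<le> 4"
      using exp_le by linarith
  qed simp
  finally have "exp (real N) \<le> 4 ^ N"
    by simp
  moreover have "1 + u < exp (real N)"
    using iffD2[OF exp_less_cancel_iff N(2)] a by simp
  ultimately have N4: "1 + u < 4 ^ N"
    by simp
  define D' where "D' j = {t\<in>D. 4 ^ j \<le> 1 + (t - a) \<and> 1 + (t - a) < 4 ^ Suc j}" for j :: nat
  define W where "W j = E \<inter> {\<omega>\<in>space M. \<exists>t\<in>D' j. y * 2 ^ j \<le> \<bar>B t \<omega> - B a \<omega>\<bar>}" for j :: nat
  have fin: "finite (D' j)" for j
    using D by (simp add: D'_def)
  have W: "W j \<in> events" for j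
    unfolding W_def using D a by (intro window_event E fin) (auto simp: D'_def)
  have bound: "prob (W j) \<le> 2 * sqrt 2 * exp (- y\<^sup>2 / 64) * prob E" for j
  proof -
    have "prob (E \<inter> {\<omega>\<in>space M. \<exists>t\<in>D' j. 2 * (y * 2 ^ j / 2) \<le> \<bar>B t \<omega> - B a \<omega>\<bar>})
        \<le> 2 * sqrt 2 * exp (- (y * 2 ^ j / 2)\<^sup>2 / (4 * (a + 4 ^ Suc j - a))) * prob E"
      using a y fin by (intro window_maximal_inequality E) (use D in \<open>auto simp: D'_def\<close>)
    also have "(y * 2 ^ j / 2)\<^sup>2 = y\<^sup>2 * (2 ^ j * 2 ^ j) / 4"
      by (simp add: power2_eq_square)
    also have "2 ^ j * 2 ^ j = (4::real) ^ j"
      by (simp flip: power_mult_distrib)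
    also have "- (y\<^sup>2 * 4 ^ j / 4) / (4 * (a + 4 ^ Suc j - a)) = - y\<^sup>2 / 64"
      by simp
    finally show ?thesis
      by (simp add: W_def)
  qed
  have cover: "E \<inter> {\<omega>\<in>space M. \<exists>t\<in>D. y * sqrt (1 + t) \<le> \<bar>B t \<omega> - B a \<omega>\<bar>} \<subseteq> (\<Union>j<N. W j)"
  proof
    fix \<omega> assume \<omega>: "\<omega> \<in> E \<inter> {\<omega>\<in>space M. \<exists>t\<in>D. y * sqrt (1 + t) \<le> \<bar>B t \<omega> - B a \<omega>\<bar>}"
    then obtain t where t: "t \<in> D" "y * sqrt (1 + t) \<le> \<bar>B t \<omega> - B a \<omega>\<bar>"
      by auto
    have ta: "a \<le> t" "t \<le> u"
      using t D by auto
    define k where "k = (LEAST k. 1 + (t - a) < 4 ^ k)"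
    have N': "1 + (t - a) < 4 ^ N"
      using N4 ta a by simp
    have k: "1 + (t - a) < 4 ^ k" "k \<le> N"
      unfolding k_def using N' by (rule LeastI, rule Least_le)
    have "k \<noteq> 0"
      using k(1) ta by (intro notI) simp
    then obtain j where j: "k = Suc j"
      by (cases k) auto
    have "\<not> 1 + (t - a) < 4 ^ j"
      using not_less_Least[of j "\<lambda>k. 1 + (t - a) < 4 ^ k"] j by (simp add: k_def)
    then have tj: "t \<in> D' j"
      using k j t by (simp add: D'_def)
    have "2 ^ j = sqrt (4 ^ j)"
      by (simp add: real_sqrt_power)
    also have "\<dots> \<le> sqrt (1 + t)"
      using tj a by (intro real_sqrt_le_mono) (auto simp: D'_def)
    finally have "y * 2 ^ j \<le> y * sqrt (1 + t)"
      using y by (rule mult_left_mono)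
    then have "\<exists>t\<in>D' j. y * 2 ^ j \<le> \<bar>B t \<omega> - B a \<omega>\<bar>"
      using t tj by (intro bexI[of _ t]) auto
    then have "\<omega> \<in> W j"
      using \<omega> by (simp add: W_def)
    then show "\<omega> \<in> (\<Union>j<N. W j)"
      using j k by auto
  qed
  have "prob (E \<inter> {\<omega>\<in>space M. \<exists>t\<in>D. y * sqrt (1 + t) \<le> \<bar>B t \<omega> - B a \<omega>\<bar>}) \<le> prob (\<Union>j<N. W j)"
    using cover W by (intro finite_measure_mono sets.finite_UN) auto
  also have "\<dots> \<le> (\<Sum>j<N. prob (W j))"
    using W by (intro finite_measure_subadditive_finite) auto
  also have "\<dots> \<le> (\<Sum>j<N. 2 * sqrt 2 * exp (- y\<^sup>2 / 64) * prob E)"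
    by (intro sum_mono bound)
  also have "\<dots> = real N * (2 * sqrt 2 * exp (- y\<^sup>2 / 64) * prob E)"
    by simp
  also have "\<dots> \<le> (1 + ln (1 + u)) * (2 * sqrt 2 * exp (- y\<^sup>2 / 64) * prob E)"
    using N by (intro mult_right_mono) auto
  finally show ?thesis
    by (simp add: mult.assoc)
qed

text \<open>
  Successive increments are conditionally unlikely to be all small, since each one exceeds its threshold with
  probability at least \<open>std_normal_density (y + 1)\<close>, whatever happened before.
\<close>

lemma small_increments:
  assumes t: "0 \<le> t 0" "\<And>j. t j < t (Suc j)" and E: "E \<in> sets (\<F> (ennreal (t 0)))" and y: "0 \<le> y"
  shows "prob (E \<inter> {\<omega>\<in>space M. \<forall>j\<in>{..<N}. \<bar>B (t (Suc j)) \<omega> - B (t j) \<omega>\<bar> \<le> y * sqrt (t (Suc j) - t j)})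
    \<le> (1 - std_normal_density (y + 1)) ^ N * prob E"
proof -
  define H where "H N = E \<inter> {\<omega>\<in>space M. \<forall>j\<in>{..<N}. \<bar>B (t (Suc j)) \<omega> - B (t j) \<omega>\<bar> \<le> y * sqrt (t (Suc j) - t j)}" for N
  have mono: "t i \<le> t j" if "i \<le> j" for i j
    using that by (rule lift_Suc_mono_le[rotated]) (simp add: t less_imp_le)
  have t_nonneg: "0 \<le> t j" for j
    using mono[OF le0, of j] t(1) by linarith
  have H_F: "H N \<in> sets (\<F> (ennreal (t N)))" for N
  proof -
    have 1: "{\<omega>\<in>space (\<F> (ennreal (t N))). \<bar>B (t (Suc j)) \<omega> - B (t j) \<omega>\<bar> \<le> y * sqrt (t (Suc j) - t j)} \<in> sets (\<F> (ennreal (t N)))"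
      if "j \<in> {..<N}" for j
    proof -
      have [measurable]: "B (t (Suc j)) \<in> borel_measurable (\<F> (ennreal (t N)))" "B (t j) \<in> borel_measurable (\<F> (ennreal (t N)))"
        using that by (auto intro!: adapted mono t_nonneg)
      show ?thesis by measurable
    qed
    have "E \<in> sets (\<F> (ennreal (t N)))"
      by (rule sets_F_mono[OF ennreal_leI E]) (simp add: mono)
    then have "E \<inter> {\<omega>\<in>space (\<F> (ennreal (t N))). \<forall>j\<in>{..<N}. \<bar>B (t (Suc j)) \<omega> - B (t j) \<omega>\<bar> \<le> y * sqrt (t (Suc j) - t j)} \<in> sets (\<F> (ennreal (t N)))"
      using 1 by (intro sets.Int sets.sets_Collect_finite_All) auto
    then show ?thesis
      by (simp add: H_def)
  qed
  have "prob (H N) \<le> (1 - std_normal_density (y + 1)) ^ N * prob E"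
  proof (induction N)
    case 0
    have "H 0 = E"
      using sets.sets_into_space[OF E] by (auto simp: H_def)
    then show ?case by simp
  next
    case (Suc N)
    let ?r = "y * sqrt (t (Suc N) - t N)"
    have nonneg: "0 \<le> 1 - std_normal_density (y + 1)"
      using normal_not_small[OF increment_normal[OF t_nonneg[of N] t(2)[of N]] _ y] t(2)[of N]
      by (intro order_trans[OF measure_nonneg]) auto
    have "H (Suc N) = H N \<inter> {\<omega>\<in>space M. B (t (Suc N)) \<omega> - B (t N) \<omega> \<in> {-?r..?r}}"
      by (auto simp: H_def lessThan_Suc abs_le_iff)
    then have "prob (H (Suc N)) = prob (H N) * prob {\<omega>\<in>space M. B (t (Suc N)) \<omega> - B (t N) \<omega> \<in> {-?r..?r}}"
      using increment_indep[OF t_nonneg t(2) H_F, of "{-?r..?r}"] by simp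
    also have "{\<omega>\<in>space M. B (t (Suc N)) \<omega> - B (t N) \<omega> \<in> {-?r..?r}} = {\<omega>\<in>space M. \<bar>B (t (Suc N)) \<omega> - B (t N) \<omega>\<bar> \<le> ?r}"
      by auto
    also have "prob (H N) * prob \<dots> \<le> ((1 - std_normal_density (y + 1)) ^ N * prob E) * (1 - std_normal_density (y + 1))"
      using t(2)[of N] y nonneg by (intro mult_mono Suc.IH normal_not_small increment_normal t_nonneg t) auto
    finally show ?case by (simp add: mult_ac)
  qed
  then show ?thesis
    by (simp add: H_def)
qed

lemma stopping_time_measurable:
  assumes "stopping_time \<F> \<tau>"
  shows "\<tau> \<in> borel_measurable M"
  using assms sub by (intro measurable_stopping_time[OF assms]) (auto simp: subalgebra_def)

lemma running_max_measurable:
  assumes "stopping_time \<F> \<tau>" "continuous_on {0..} w" "\<And>t. 0 \<le> t \<Longrightarrow> 1 \<le> w t"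
  shows "(\<lambda>\<omega>. running_max (\<lambda>t. \<bar>B t \<omega>\<bar> / w t) (\<tau> \<omega>)) \<in> borel_measurable M"
proof (rule borel_measurable_running_max)
  show "\<tau> \<in> borel_measurable M"
    by (rule stopping_time_measurable) fact
  show "(\<lambda>\<omega>. \<bar>B t \<omega>\<bar> / w t) \<in> borel_measurable M" if "0 \<le> t" for t
    using B_measurable[OF that] by simp
  have "w t \<noteq> 0" if "0 \<le> t" for t
    using assms(3)[OF that] by auto
  then show "AE \<omega> in M. continuous_on {0..} (\<lambda>t. \<bar>B t \<omega>\<bar> / w t)"
    by (intro AE_mp[OF B_continuous AE_I2] impI) (auto intro!: continuous_intros assms(2))
qed

section \<open>A large maximum within a short time\<close>

text \<open>
  After \<open>\<bar>B\<bar> / w\<close> has reached the level \<open>\<theta>\<close>, it has to move on to \<open>2 \<theta>\<close> before time \<open>u\<close>.  By assumption such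
  a displacement has conditional probability at most \<open>\<epsilon>\<close>, whatever the time \<open>a\<close> of passage.  To avoid the
  strong Markov property at a continuous passage time, passage is observed on the grids \<open>u k / 2 ^ n\<close>; the
  overshoot over \<open>\<theta>\<close> is then at most one grid increment, which exceeds \<open>\<theta> / 2\<close> with vanishing probability
  as the grid is refined.  This explains why the window hypothesis only has \<open>\<theta> / 2\<close> in place of \<open>\<theta>\<close>.
\<close>

lemma upper_good_lambda:
  assumes \<tau>: "stopping_time \<F> \<tau>"
    and w: "continuous_on {0..} w" "\<And>t. 0 \<le> t \<Longrightarrow> 1 \<le> w t" "mono_on {0..} w"
    and u: "0 < u" and \<theta>: "0 < \<theta>" and \<epsilon>: "0 \<le> \<epsilon>"
    and window: "\<And>a E D. 0 \<le> a \<Longrightarrow> a \<le> u \<Longrightarrow> E \<in> sets (\<F> (ennreal a)) \<Longrightarrow> finite D \<Longrightarrow> D \<subseteq> {a..u} \<Longrightarrow>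
      prob (E \<inter> {\<omega>\<in>space M. \<exists>t\<in>D. \<theta> / 2 * w t \<le> \<bar>B t \<omega> - B a \<omega>\<bar>}) \<le> \<epsilon> * prob E"
  shows "prob {\<omega>\<in>space M. ennreal (2 * \<theta>) < running_max (\<lambda>t. \<bar>B t \<omega>\<bar> / w t) (\<tau> \<omega>) \<and> \<tau> \<omega> \<le> ennreal u}
    \<le> \<epsilon> * prob {\<omega>\<in>space M. ennreal \<theta> \<le> running_max (\<lambda>t. \<bar>B t \<omega>\<bar> / w t) (\<tau> \<omega>)}"
proof -
  define R where "R \<omega> = running_max (\<lambda>t. \<bar>B t \<omega>\<bar> / w t) (\<tau> \<omega>)" for \<omega>
  have [measurable]: "R \<in> borel_measurable M"
    unfolding R_def by (rule running_max_measurable) fact+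
  have [measurable]: "\<tau> \<in> borel_measurable M"
    by (rule stopping_time_measurable) fact
  have wpos: "0 < w t" if "0 \<le> t" for t
    using w(2)[OF that] by linarith
  define HU where "HU = {\<omega>\<in>space M. ennreal \<theta> \<le> R \<omega>}"
  have HU[measurable]: "HU \<in> events"
    unfolding HU_def by measurable
  define T where "T n k = u * real k / 2 ^ n" for n k :: nat
  have T_nonneg: "0 \<le> T n k" for n k
    using u by (simp add: T_def)
  have T_le: "T n k \<le> T n l" if "k \<le> l" for n k l
    using u that by (simp add: T_def divide_right_mono)
  have T_u: "T n k \<le> u" if "k \<le> 2 ^ n" for n k
  proof -
    have "real k \<le> 2 ^ n"
      using that by (metis of_nat_le_iff of_nat_numeral of_nat_power)
    then show ?thesis
      using u by (simp add: T_def divide_le_eq)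
  qed
  have BT[measurable]: "B (T n k) \<in> borel_measurable M" for n k
    by (rule B_measurable[OF T_nonneg])
  \<comment> \<open>\<open>G n\<close>: the level \<open>2 \<theta>\<close> is exceeded on the grid up to \<open>\<tau>\<close>; \<open>J n\<close>: some grid increment is large;
     \<open>H n k\<close>: the level \<open>\<theta>\<close> is first reached at the grid point \<open>k\<close>, up to \<open>\<tau>\<close>; \<open>W n k\<close>: a large displacement
     follows; \<open>Z\<close>: the null event on which the path does not start at the origin.\<close>
  define G where "G n = {\<omega>\<in>space M. \<exists>k\<in>{..2 ^ n}. ennreal (T n k) \<le> \<tau> \<omega> \<and> 2 * \<theta> * w (T n k) < \<bar>B (T n k) \<omega>\<bar>}" for n
  define J where "J n = {\<omega>\<in>space M. \<exists>k\<in>{..<2 ^ n}. \<theta> / 2 \<le> \<bar>B (T n (Suc k)) \<omega> - B (T n k) \<omega>\<bar>}" for n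
  define H where "H n k = {\<omega>\<in>space M. ennreal (T n k) \<le> \<tau> \<omega>} \<inter> {\<omega>\<in>space M. \<theta> * w (T n k) \<le> \<bar>B (T n k) \<omega>\<bar>}
    \<inter> {\<omega>\<in>space M. \<forall>j\<in>{..<k}. \<bar>B (T n j) \<omega>\<bar> < \<theta> * w (T n j)}" for n k
  define W where "W n k = {\<omega>\<in>space M. \<exists>t\<in>T n ` {k..2 ^ n}. \<theta> / 2 * w t \<le> \<bar>B t \<omega> - B (T n k) \<omega>\<bar>}" for n k
  define Z where "Z = {\<omega>\<in>space M. B 0 \<omega> \<noteq> 0}"
  have G[measurable]: "G n \<in> events" for n
    unfolding G_def by (intro sets.sets_Collect_finite_Ex) auto
  have J[measurable]: "J n \<in> events" for n
    unfolding J_def by (intro sets.sets_Collect_finite_Ex) auto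
  have [measurable]: "B 0 \<in> borel_measurable M"
    by (rule B_measurable) simp
  have Z: "Z \<in> events" "prob Z = 0"
  proof -
    show "Z \<in> events"
      unfolding Z_def by measurable
    have "AE \<omega> in M. \<omega> \<notin> Z"
      using B_0 by eventually_elim (simp add: Z_def)
    then show "prob Z = 0"
      using \<open>Z \<in> events\<close> by (simp add: prob_eq_0)
  qed
  have H_F: "H n k \<in> sets (\<F> (ennreal (T n k)))" for n k
  proof -
    have 1: "{\<omega>\<in>space M. ennreal (T n k) \<le> \<tau> \<omega>} \<in> sets (\<F> (ennreal (T n k)))"
    proof -
      have "Measurable.pred (\<F> (ennreal (T n k))) (\<lambda>\<omega>. \<tau> \<omega> < ennreal (T n k))"
        by (rule filtration.stopping_time_less_const[OF filt \<tau>])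
      then have "Measurable.pred (\<F> (ennreal (T n k))) (\<lambda>\<omega>. \<not> \<tau> \<omega> < ennreal (T n k))"
        by measurable
      then show ?thesis
        by (simp add: pred_def not_less)
    qed
    have B: "B (T n j) \<in> borel_measurable (\<F> (ennreal (T n k)))" if "j \<le> k" for j
      using T_nonneg T_le[OF that] by (rule adapted)
    have 2: "{\<omega>\<in>space (\<F> (ennreal (T n k))). \<theta> * w (T n k) \<le> \<bar>B (T n k) \<omega>\<bar>} \<in> sets (\<F> (ennreal (T n k)))"
    proof -
      note B[OF order_refl, measurable]
      show ?thesis by measurable
    qed
    have 3: "{\<omega>\<in>space (\<F> (ennreal (T n k))). \<forall>j\<in>{..<k}. \<bar>B (T n j) \<omega>\<bar> < \<theta> * w (T n j)} \<in> sets (\<F> (ennreal (T n k)))"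
    proof (intro sets.sets_Collect_finite_All)
      fix j assume "j \<in> {..<k}"
      then have [measurable]: "B (T n j) \<in> borel_measurable (\<F> (ennreal (T n k)))"
        by (intro B) simp
      show "{\<omega>\<in>space (\<F> (ennreal (T n k))). \<bar>B (T n j) \<omega>\<bar> < \<theta> * w (T n j)} \<in> sets (\<F> (ennreal (T n k)))"
        by measurable
    qed simp
    show ?thesis
      using 1 2 3 unfolding H_def by simp
  qed
  have H: "H n k \<in> events" for n k
    using H_F by (rule sets_F_events)
  have HW: "prob (H n k \<inter> W n k) \<le> \<epsilon> * prob (H n k)" if "k \<le> 2 ^ n" for n k
    unfolding W_def by (rule window) (use H_F T_nonneg T_u T_le that in auto)
  have HW_events: "H n k \<inter> W n k \<in> events" for n k
    unfolding W_def by (rule window_event) (use H_F T_nonneg in auto)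
  have H_HU: "H n k \<subseteq> HU" for n k
  proof
    fix \<omega> assume \<omega>: "\<omega> \<in> H n k"
    then have "\<theta> \<le> \<bar>B (T n k) \<omega>\<bar> / w (T n k)"
      using wpos[OF T_nonneg, of n k] by (simp add: H_def le_divide_eq)
    then have "ennreal \<theta> \<le> ennreal (\<bar>B (T n k) \<omega>\<bar> / w (T n k))"
      by (rule ennreal_leI)
    also have "\<dots> \<le> R \<omega>"
      unfolding R_def using \<omega> T_nonneg by (intro le_running_max[of _ _ "\<lambda>t. \<bar>B t \<omega>\<bar> / w t"]) (auto simp: H_def)
    finally show "\<omega> \<in> HU"
      using \<omega> by (simp add: HU_def H_def)
  qed
  have H_disj: "H n k \<inter> H n l = {}" if "k \<noteq> l" for n k l
    using that by (cases k l rule: linorder_cases) (force simp: H_def)+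
  have step: "prob (G n) \<le> prob (J n) + \<epsilon> * prob HU" for n
  proof -
    have sub: "G n \<subseteq> J n \<union> Z \<union> (\<Union>k\<in>{..2 ^ n}. H n k \<inter> W n k)"
    proof
      fix \<omega> assume \<omega>: "\<omega> \<in> G n"
      show "\<omega> \<in> J n \<union> Z \<union> (\<Union>k\<in>{..2 ^ n}. H n k \<inter> W n k)"
      proof (rule ccontr)
        assume not: "\<omega> \<notin> J n \<union> Z \<union> (\<Union>k\<in>{..2 ^ n}. H n k \<inter> W n k)"
        have sp: "\<omega> \<in> space M"
          using \<omega> by (simp add: G_def)
        obtain m where m: "m \<le> 2 ^ n" "ennreal (T n m) \<le> \<tau> \<omega>" "2 * \<theta> * w (T n m) < \<bar>B (T n m) \<omega>\<bar>"
          using \<omega> by (auto simp: G_def)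
        define k where "k = (LEAST k. \<theta> * w (T n k) \<le> \<bar>B (T n k) \<omega>\<bar>)"
        have "\<theta> * w (T n m) \<le> \<bar>B (T n m) \<omega>\<bar>"
          using m(3) mult_pos_pos[OF \<theta> wpos[OF T_nonneg, of n m]] by simp
        then have k: "\<theta> * w (T n k) \<le> \<bar>B (T n k) \<omega>\<bar>" "k \<le> m"
          unfolding k_def by (rule LeastI, rule Least_le)
        have before: "\<bar>B (T n j) \<omega>\<bar> < \<theta> * w (T n j)" if "j < k" for j
          using not_less_Least[of j "\<lambda>k. \<theta> * w (T n k) \<le> \<bar>B (T n k) \<omega>\<bar>"] that by (simp add: k_def not_le)
        have "ennreal (T n k) \<le> \<tau> \<omega>"
          by (rule order_trans[OF ennreal_leI m(2)]) (rule T_le[OF k(2)])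
        then have Hk: "\<omega> \<in> H n k"
          using sp k before by (simp add: H_def)
        \<comment> \<open>The overshoot is bounded by comparing with the previous grid point, which exists because \<open>B\<close> starts below \<open>\<theta>\<close>.\<close>
        have "k \<noteq> 0"
        proof
          assume "k = 0"
          then have "\<theta> * w 0 \<le> \<bar>B 0 \<omega>\<bar>"
            using k(1) by (simp add: T_def)
          moreover have "0 < \<theta> * w 0"
            using \<theta> wpos by simp
          ultimately have "\<omega> \<in> Z"
            using sp by (auto simp: Z_def)
          then show False
            using not by simp
        qed
        then obtain j where j: "k = Suc j"
          by (cases k) auto
        have "j \<in> {..<2 ^ n}"
          using j k m by simp
        then have "\<bar>B (T n k) \<omega> - B (T n j) \<omega>\<bar> < \<theta> / 2"
          using not sp by (auto simp: J_def j not_le)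
        moreover have "\<bar>B (T n j) \<omega>\<bar> < \<theta> * w (T n j)"
          by (rule before) (simp add: j)
        moreover have "\<theta> * w (T n j) \<le> \<theta> * w (T n k)"
          using \<theta> T_nonneg by (intro mult_left_mono mono_onD[OF w(3)] T_le) (auto simp: j)
        ultimately have Bk: "\<bar>B (T n k) \<omega>\<bar> < \<theta> * w (T n k) + \<theta> / 2"
          by linarith
        have wk: "\<theta> * w (T n k) \<le> \<theta> * w (T n m)"
          using \<theta> T_nonneg k(2) by (intro mult_left_mono mono_onD[OF w(3)] T_le) auto
        have "\<theta> \<le> \<theta> * w (T n m)"
          using \<theta> w(2)[OF T_nonneg, of n m] by simp
        moreover have "2 * (\<theta> * w (T n m)) < \<bar>B (T n m) \<omega>\<bar>"
          using m(3) by (simp only: mult.assoc)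
        ultimately have "(\<theta> * w (T n m)) / 2 \<le> \<bar>B (T n m) \<omega> - B (T n k) \<omega>\<bar>"
          using Bk wk by linarith
        then have "\<theta> / 2 * w (T n m) \<le> \<bar>B (T n m) \<omega> - B (T n k) \<omega>\<bar>"
          by simp
        then have "\<omega> \<in> W n k"
          using k(2) m(1) sp by (auto simp: W_def)
        then show False
          using not Hk k(2) m(1) by auto
      qed
    qed
    have "prob (G n) \<le> prob (J n \<union> Z \<union> (\<Union>k\<in>{..2 ^ n}. H n k \<inter> W n k))"
      using sub Z HW_events by (intro finite_measure_mono sets.Un sets.finite_UN J) auto
    also have "\<dots> \<le> prob (J n \<union> Z) + prob (\<Union>k\<in>{..2 ^ n}. H n k \<inter> W n k)"
      using Z HW_events by (intro measure_Un_le sets.Un sets.finite_UN J) auto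
    also have "prob (J n \<union> Z) \<le> prob (J n) + prob Z"
      using Z by (intro measure_Un_le J) auto
    also have "prob (\<Union>k\<in>{..2 ^ n}. H n k \<inter> W n k) \<le> (\<Sum>k\<in>{..2 ^ n}. prob (H n k \<inter> W n k))"
      using HW_events by (intro finite_measure_subadditive_finite) auto
    also have "\<dots> \<le> (\<Sum>k\<in>{..2 ^ n}. \<epsilon> * prob (H n k))"
      by (intro sum_mono HW) simp
    also have "\<dots> = \<epsilon> * (\<Sum>k\<in>{..2 ^ n}. prob (H n k))"
      by (simp add: sum_distrib_left)
    also have "(\<Sum>k\<in>{..2 ^ n}. prob (H n k)) = prob (\<Union>k\<in>{..2 ^ n}. H n k)"
      using H H_disj by (intro finite_measure_finite_Union[symmetric]) (auto simp: disjoint_family_on_def)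
    also have "\<epsilon> * \<dots> \<le> \<epsilon> * prob HU"
      using H_HU by (intro mult_left_mono[OF _ \<epsilon>] finite_measure_mono) auto
    finally show ?thesis
      using Z by simp
  qed
  have J_bound: "prob (J n) \<le> 2 ^ n * (sqrt 2 * exp (- (\<theta> / 2)\<^sup>2 / (4 * (u / 2 ^ n))))" for n
  proof -
    have "prob (J n) \<le> prob (\<Union>k\<in>{..<2 ^ n}. {\<omega>\<in>space M. \<theta> / 2 \<le> \<bar>B (T n (Suc k)) \<omega> - B (T n k) \<omega>\<bar>})"
      by (intro finite_measure_mono sets.finite_UN) (auto simp: J_def)
    also have "\<dots> \<le> (\<Sum>k\<in>{..<2 ^ n}. prob {\<omega>\<in>space M. \<theta> / 2 \<le> \<bar>B (T n (Suc k)) \<omega> - B (T n k) \<omega>\<bar>})"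
      by (intro finite_measure_subadditive_finite) auto
    also have "\<dots> \<le> (\<Sum>k\<in>{..<2 ^ n::nat}. sqrt 2 * exp (- (\<theta> / 2)\<^sup>2 / (4 * (u / 2 ^ n))))"
    proof (intro sum_mono increment_tail T_nonneg)
      fix k
      have "T n (Suc k) - T n k = u / 2 ^ n"
        by (simp add: T_def field_simps)
      moreover have "0 < u / 2 ^ n"
        using u by simp
      ultimately show "T n k < T n (Suc k)" "T n (Suc k) - T n k \<le> u / 2 ^ n"
        by linarith+
    qed (use \<theta> in simp)
    finally show ?thesis by simp
  qed
  have J_lim: "(\<lambda>n. prob (J n)) \<longlonglongrightarrow> 0"
  proof (rule tendsto_sandwich[OF _ _ tendsto_const])
    define c where "c = (\<theta> / 2)\<^sup>2 / (4 * u)"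
    have c: "0 < c"
      using \<theta> u by (simp add: c_def)
    have "((\<lambda>x::real. x * (sqrt 2 * exp (- c * x))) \<longlongrightarrow> 0) at_top"
      using c by real_asymp
    moreover have "filterlim (\<lambda>n. (2::real) ^ n) at_top sequentially"
      by real_asymp
    ultimately have "((\<lambda>n. (2::real) ^ n * (sqrt 2 * exp (- c * 2 ^ n))) \<longlonglongrightarrow> 0)"
      by (rule filterlim_compose)
    moreover have "- c * 2 ^ n = - (\<theta> / 2)\<^sup>2 / (4 * (u / 2 ^ n))" for n :: nat
      by (simp add: c_def)
    ultimately show "(\<lambda>n. 2 ^ n * (sqrt 2 * exp (- (\<theta> / 2)\<^sup>2 / (4 * (u / 2 ^ n))))) \<longlonglongrightarrow> 0"
      by simp
  qed (use J_bound in auto)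
  \<comment> \<open>The grids are nested, so the events \<open>G n\<close> increase, and their union contains the event in question.\<close>
  have "incseq G"
  proof (rule incseq_SucI)
    fix n
    have "T n k = T (Suc n) (2 * k)" for k
      by (simp add: T_def)
    then show "G n \<subseteq> G (Suc n)"
      by (auto simp: G_def intro!: bexI[of _ "2 * _"])
  qed
  then have G_lim: "(\<lambda>n. prob (G n)) \<longlonglongrightarrow> prob (\<Union>n. G n)"
    using G by (intro finite_Lim_measure_incseq) auto
  have "(\<lambda>n. prob (J n) + \<epsilon> * prob HU) \<longlonglongrightarrow> 0 + \<epsilon> * prob HU"
    by (intro tendsto_add J_lim tendsto_const)
  then have bound: "prob (\<Union>n. G n) \<le> \<epsilon> * prob HU"
    using LIMSEQ_le[OF G_lim] step by fastforce
  have "AE \<omega> in M. \<omega> \<in> {\<omega>\<in>space M. ennreal (2 * \<theta>) < R \<omega> \<and> \<tau> \<omega> \<le> ennreal u} \<longrightarrow> \<omega> \<in> (\<Union>n. G n)"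
    using B_continuous
  proof eventually_elim
    case (elim \<omega>)
    show ?case
    proof
      assume \<omega>: "\<omega> \<in> {\<omega>\<in>space M. ennreal (2 * \<theta>) < R \<omega> \<and> \<tau> \<omega> \<le> ennreal u}"
      then obtain t where t: "0 \<le> t" "ennreal t \<le> \<tau> \<omega>" "2 * \<theta> < \<bar>B t \<omega>\<bar> / w t"
        using less_running_max_iff[of "2 * \<theta>" "\<lambda>t. \<bar>B t \<omega>\<bar> / w t" "\<tau> \<omega>"] \<theta> by (auto simp: R_def)
      have "ennreal t \<le> ennreal u"
        using t(2) \<omega> by auto
      then have tu: "t \<le> u"
        using u by (simp add: ennreal_le_iff)
      have "w t \<noteq> 0" if "0 \<le> t" for t
        using wpos[OF that] by simp
      then have cont: "continuous_on {0..} (\<lambda>t. \<bar>B t \<omega>\<bar> / w t)"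
        using elim by (auto intro!: continuous_intros w)
      let ?Q = "{T n k |n k. k \<le> 2 ^ n}"
      have "\<exists>q\<in>?Q. 0 \<le> q \<and> q \<le> t \<and> ennreal q \<le> \<tau> \<omega> \<and> 2 * \<theta> < \<bar>B q \<omega>\<bar> / w q"
        using cont t
      proof (rule dense_time_below)
        show "0 \<in> ?Q"
          by (auto simp: T_def intro!: exI[of _ 0])
        fix x y :: real assume xy: "0 \<le> x" "x < y" "y \<le> t"
        obtain n :: nat where n: "u / (y - x) < 2 ^ n"
          using real_arch_pow[of 2 "u / (y - x)"] by auto
        then have gap: "u < (y - x) * 2 ^ n"
          using xy by (simp add: divide_less_eq mult.commute)
        define k where "k = nat \<lfloor>x * 2 ^ n / u\<rfloor> + 1"
        have "0 \<le> x * 2 ^ n / u"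
          using xy u by simp
        then have k: "x * 2 ^ n / u < real k" "real k \<le> x * 2 ^ n / u + 1"
          unfolding k_def by linarith+
        have "x < T n k"
          using k(1) u by (simp add: T_def field_simps)
        moreover have "u * real k \<le> x * 2 ^ n + u"
          using k(2) u by (simp add: field_simps)
        then have "u * real k < y * 2 ^ n"
          using gap by (simp add: algebra_simps)
        then have ky: "T n k < y"
          by (simp add: T_def divide_less_eq)
        moreover have "k \<le> 2 ^ n"
        proof -
          have "u * real k < u * 2 ^ n"
            using xy tu by (intro order.strict_trans2[OF \<open>u * real k < y * 2 ^ n\<close>] mult_right_mono) auto
          then have "real k < 2 ^ n"
            using mult_less_cancel_left_pos[OF u] by blast
          then show ?thesis
            by (metis less_imp_le of_nat_less_iff of_nat_numeral of_nat_power)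
        qed
        ultimately show "\<exists>q\<in>?Q. x < q \<and> q < y"
          by blast
      qed
      then obtain n k where nk: "k \<le> 2 ^ n" "ennreal (T n k) \<le> \<tau> \<omega>" "2 * \<theta> < \<bar>B (T n k) \<omega>\<bar> / w (T n k)"
        by blast
      have "2 * \<theta> * w (T n k) < \<bar>B (T n k) \<omega>\<bar>"
        using nk(3) wpos[OF T_nonneg, of n k] by (simp add: less_divide_eq)
      then have "\<omega> \<in> G n"
        using nk \<omega> by (auto simp: G_def)
      then show "\<omega> \<in> (\<Union>n. G n)"
        by blast
    qed
  qed
  then have "prob {\<omega>\<in>space M. ennreal (2 * \<theta>) < R \<omega> \<and> \<tau> \<omega> \<le> ennreal u} \<le> prob (\<Union>n. G n)"
    by (intro finite_measure_mono_AE) auto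
  with bound show ?thesis
    by (simp add: HU_def R_def)
qed

section \<open>A small maximum over a long time\<close>

lemma after_event:
  assumes "stopping_time \<F> \<tau>"
  shows "{\<omega>\<in>space M. ennreal s < \<tau> \<omega>} \<in> sets (\<F> (ennreal s))"
  using stopping_timeD2[OF assms, of "ennreal s"] by (simp add: pred_def)

text \<open>
  On \<open>\<tau> > u\<close>, a maximum of \<open>\<bar>B\<bar> / w\<close> below \<open>r\<close> forces every increment between times up to \<open>u\<close> to be small.
  The event \<open>\<tau> > t 0\<close> belongs to the past of all these increments.
\<close>

lemma lower_good_lambda_increments:
  assumes \<tau>: "stopping_time \<F> \<tau>"
    and t: "0 \<le> t 0" "\<And>j. t j < t (Suc j)" and u: "t N \<le> u"
    and w: "\<And>t. 0 \<le> t \<Longrightarrow> 0 < w t" and y: "0 \<le> y" and r: "0 \<le> r"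
    and small: "\<And>j. j < N \<Longrightarrow> r * (w (t j) + w (t (Suc j))) \<le> y * sqrt (t (Suc j) - t j)"
  shows "prob {\<omega>\<in>space M. ennreal u < \<tau> \<omega> \<and> running_max (\<lambda>t. \<bar>B t \<omega>\<bar> / w t) (\<tau> \<omega>) \<le> ennreal r}
    \<le> (1 - std_normal_density (y + 1)) ^ N * prob {\<omega>\<in>space M. ennreal (t 0) < \<tau> \<omega>}"
  (is "prob ?S \<le> _ * prob ?E")
proof -
  have mono: "t i \<le> t j" if "i \<le> j" for i j
    using that by (rule lift_Suc_mono_le[rotated]) (simp add: t less_imp_le)
  have t_nonneg: "0 \<le> t j" for j
    using mono[OF le0, of j] t(1) by linarith
  let ?I = "{\<omega>\<in>space M. \<forall>j\<in>{..<N}. \<bar>B (t (Suc j)) \<omega> - B (t j) \<omega>\<bar> \<le> y * sqrt (t (Suc j) - t j)}"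
  have "?S \<subseteq> ?E \<inter> ?I"
  proof (intro subsetI IntI CollectI conjI ballI)
    fix \<omega> assume \<omega>: "\<omega> \<in> ?S"
    then show "\<omega> \<in> space M" by simp
    then show "\<omega> \<in> space M" .
    have before: "ennreal (t j) < \<tau> \<omega>" if "j \<le> N" for j
      using \<omega> mono[OF that] u by (auto intro!: ennreal_leI order.strict_trans1[of _ "ennreal u"])
    show "ennreal (t 0) < \<tau> \<omega>"
      by (rule before) simp
    fix j assume "j \<in> {..<N}"
    then have j: "j < N" by simp
    have B: "\<bar>B (t i) \<omega>\<bar> \<le> r * w (t i)" if "i \<le> N" for i
    proof -
      have "ennreal (\<bar>B (t i) \<omega>\<bar> / w (t i)) \<le> running_max (\<lambda>t. \<bar>B t \<omega>\<bar> / w t) (\<tau> \<omega>)"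
        using before[OF that] t_nonneg by (intro le_running_max[of _ _ "\<lambda>t. \<bar>B t \<omega>\<bar> / w t"]) auto
      also have "\<dots> \<le> ennreal r"
        using \<omega> by simp
      finally show ?thesis
        using w[OF t_nonneg, of i] r by (simp add: ennreal_le_iff divide_le_eq)
    qed
    have "\<bar>B (t (Suc j)) \<omega> - B (t j) \<omega>\<bar> \<le> r * w (t (Suc j)) + r * w (t j)"
      using B[OF less_imp_le[OF j]] B[OF Suc_leI[OF j]] by linarith
    also have "\<dots> = r * (w (t j) + w (t (Suc j)))"
      by (simp add: algebra_simps)
    also have "\<dots> \<le> y * sqrt (t (Suc j) - t j)"
      by (rule small[OF j])
    finally show "\<bar>B (t (Suc j)) \<omega> - B (t j) \<omega>\<bar> \<le> y * sqrt (t (Suc j) - t j)" .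
  qed
  moreover have "?E \<inter> ?I \<in> events"
  proof (rule sets.Int)
    show "?E \<in> events"
      by (rule sets_F_events[OF after_event[OF \<tau>]])
    show "?I \<in> events"
    proof (intro sets.sets_Collect_finite_All)
      fix j
      have [measurable]: "B (t i) \<in> borel_measurable M" for i
        by (rule B_measurable[OF t_nonneg])
      show "{\<omega>\<in>space M. \<bar>B (t (Suc j)) \<omega> - B (t j) \<omega>\<bar> \<le> y * sqrt (t (Suc j) - t j)} \<in> events"
        by measurable
    qed simp
  qed
  ultimately have "prob ?S \<le> prob (?E \<inter> ?I)"
    by (rule finite_measure_mono)
  also have "\<dots> \<le> (1 - std_normal_density (y + 1)) ^ N * prob ?E"
    by (rule small_increments[of t, OF t after_event[OF \<tau>] y])
  finally show ?thesis .
qed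

text \<open>
  The case of one increment, with a bound that becomes small together with \<open>r\<close>; the Gaussian factor of the
  preceding lemma stays away from \<open>0\<close> for a bounded number of increments.
\<close>

lemma lower_good_lambda_single:
  assumes \<tau>: "stopping_time \<F> \<tau>" and su: "0 \<le> s" "s < u"
    and w: "\<And>t. 0 \<le> t \<Longrightarrow> 0 < w t" and r: "0 \<le> r"
  shows "prob {\<omega>\<in>space M. ennreal u < \<tau> \<omega> \<and> running_max (\<lambda>t. \<bar>B t \<omega>\<bar> / w t) (\<tau> \<omega>) \<le> ennreal r}
    \<le> (r * (w s + w u) / sqrt (u - s)) * prob {\<omega>\<in>space M. ennreal s < \<tau> \<omega>}"
  (is "prob ?S \<le> _ * prob ?E")
proof -
  let ?r = "r * (w s + w u)"
  have r': "0 \<le> ?r"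
    using r w[of s] w[of u] su by simp
  have [measurable]: "B s \<in> borel_measurable M" "B u \<in> borel_measurable M"
    using su by (auto intro!: B_measurable)
  have E: "?E \<in> events"
    by (rule sets_F_events[OF after_event[OF \<tau>]])
  have "?S \<subseteq> ?E \<inter> {\<omega>\<in>space M. B u \<omega> - B s \<omega> \<in> {-?r..?r}}"
  proof (intro subsetI)
    fix \<omega> assume \<omega>: "\<omega> \<in> ?S"
    have B: "\<bar>B t \<omega>\<bar> \<le> r * w t" if "0 \<le> t" "ennreal t \<le> \<tau> \<omega>" for t
    proof -
      have "ennreal (\<bar>B t \<omega>\<bar> / w t) \<le> running_max (\<lambda>t. \<bar>B t \<omega>\<bar> / w t) (\<tau> \<omega>)"
        using that by (intro le_running_max[of _ _ "\<lambda>t. \<bar>B t \<omega>\<bar> / w t"]) auto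
      also have "\<dots> \<le> ennreal r"
        using \<omega> by simp
      finally show ?thesis
        using w[OF that(1)] r by (simp add: ennreal_le_iff divide_le_eq)
    qed
    have s: "ennreal s < \<tau> \<omega>"
      using \<omega> su by (auto intro!: ennreal_leI order.strict_trans1[of _ "ennreal u"])
    have "\<bar>B s \<omega>\<bar> \<le> r * w s" "\<bar>B u \<omega>\<bar> \<le> r * w u"
      using B[of s] B[of u] su s \<omega> by auto
    then have "\<bar>B u \<omega> - B s \<omega>\<bar> \<le> ?r"
      by (simp add: algebra_simps)
    then show "\<omega> \<in> ?E \<inter> {\<omega>\<in>space M. B u \<omega> - B s \<omega> \<in> {-?r..?r}}"
      using s \<omega> by auto
  qed
  then have "prob ?S \<le> prob (?E \<inter> {\<omega>\<in>space M. B u \<omega> - B s \<omega> \<in> {-?r..?r}})"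
    using E by (intro finite_measure_mono) auto
  also have "\<dots> = prob ?E * prob {\<omega>\<in>space M. B u \<omega> - B s \<omega> \<in> {-?r..?r}}"
    by (rule increment_indep[OF su after_event[OF \<tau>]]) simp
  also have "{\<omega>\<in>space M. B u \<omega> - B s \<omega> \<in> {-?r..?r}} = {\<omega>\<in>space M. \<bar>B u \<omega> - B s \<omega>\<bar> \<le> ?r}"
    by auto
  also have "prob ?E * prob \<dots> \<le> prob ?E * (?r / sqrt (u - s))"
    using su r' by (intro mult_left_mono normal_small_ball[OF increment_normal]) auto
  finally show ?thesis
    by (simp add: mult.commute)
qed

end

section \<open>The iterated-logarithm clock and the choice of constants\<close>

definition iterlog :: "real \<Rightarrow> real" where
  "iterlog t = sqrt (ln (1 + ln (1 + t)))"

definition iterlog_inv :: "real \<Rightarrow> real" where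
  "iterlog_inv x = exp (exp (x\<^sup>2) - 1) - 1"

lemma iterlog_inv_nonneg: "0 \<le> iterlog_inv x"
  by (simp add: iterlog_inv_def)

lemma iterlog_inv_pos: "0 < x \<Longrightarrow> 0 < iterlog_inv x"
  by (simp add: iterlog_inv_def)

lemma iterlog_inv_mono: "0 \<le> x \<Longrightarrow> x \<le> y \<Longrightarrow> iterlog_inv x \<le> iterlog_inv y"
  by (simp add: iterlog_inv_def power_mono)

lemma iterlog_iterlog_inv: "0 \<le> x \<Longrightarrow> iterlog (iterlog_inv x) = x"
  by (simp add: iterlog_def iterlog_inv_def)

lemma iterlog_nonneg: "0 \<le> t \<Longrightarrow> 0 \<le> iterlog t"
  by (simp add: iterlog_def)

lemma strict_mono_iterlog: "strict_mono_on {0..} iterlog"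
proof (rule strict_mono_onI)
  fix r s :: real assume rs: "r \<in> {0..}" "s \<in> {0..}" "r < s"
  then have "ln (1 + r) < ln (1 + s)" "0 \<le> ln (1 + r)"
    by auto
  then have "ln (1 + ln (1 + r)) < ln (1 + ln (1 + s))"
    by simp
  then show "iterlog r < iterlog s"
    by (simp add: iterlog_def)
qed

lemma continuous_on_iterlog: "continuous_on {0..} iterlog"
proof -
  have "1 + ln (1 + t) \<noteq> 0" if "0 \<le> t" for t :: real
    using ln_ge_zero[of "1 + t"] that by linarith
  then show ?thesis
    unfolding iterlog_def by (intro continuous_intros) auto
qed

lemma exp_diff_ge:
  fixes a b :: real
  assumes "0 \<le> b" "b \<le> a"
  shows "a - b \<le> exp a - exp b"
proof -
  have "a - b \<le> exp (a - b) - 1"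
    using exp_ge_add_one_self[of "a - b"] by linarith
  then have "1 * (a - b) \<le> exp b * (exp (a - b) - 1)"
    using assms by (intro mult_mono) auto
  also have "\<dots> = exp a - exp b"
    by (simp add: algebra_simps flip: exp_add)
  finally show ?thesis by simp
qed

lemma exp_minus_one_le:
  fixes x :: real
  shows "exp x - 1 \<le> x * exp x"
proof -
  have "exp x * (1 - x) \<le> exp x * exp (- x)"
    using exp_ge_add_one_self[of "- x"] by (intro mult_left_mono) auto
  then show ?thesis
    by (simp add: algebra_simps flip: exp_add)
qed

text \<open>
  Near \<open>0\<close> the inverse clock is quadratic, like that of \<open>sqrt\<close>.
\<close>

lemma iterlog_inv_le:
  assumes "x\<^sup>2 \<le> b"
  shows "iterlog_inv x \<le> x\<^sup>2 * (exp b * exp (exp b - 1))"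
proof -
  have "iterlog_inv x \<le> (exp (x\<^sup>2) - 1) * exp (exp (x\<^sup>2) - 1)"
    unfolding iterlog_inv_def by (rule exp_minus_one_le)
  also have "\<dots> \<le> (x\<^sup>2 * exp (x\<^sup>2)) * exp (exp (x\<^sup>2) - 1)"
    by (intro mult_right_mono exp_minus_one_le) simp
  also have "\<dots> \<le> (x\<^sup>2 * exp b) * exp (exp b - 1)"
    using assms by (intro mult_mono mult_left_mono) auto
  finally show ?thesis
    by (simp add: mult.assoc)
qed

text \<open>
  The two alternatives are the bounds of the unweighted and of the weighted window.  For large \<open>\<theta>\<close> the weighted
  window is used: its number of scales \<open>1 + ln (1 + iterlog_inv (\<delta> \<theta>)) = exp (\<delta>\<^sup>2 \<theta>\<^sup>2)\<close> is
  absorbed by the Gaussian factor \<open>exp (- \<theta>\<^sup>2 / 256)\<close> when \<open>\<delta>\<^sup>2 \<le> 1 / 512\<close>; this is where the iterated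
  logarithm comes from.  For bounded \<open>\<theta>\<close> the time horizon is of order \<open>\<delta>\<^sup>2 \<theta>\<^sup>2\<close>, and one window suffices.
\<close>

lemma upper_constants:
  fixes \<epsilon> :: real
  assumes "0 < \<epsilon>"
  shows "\<exists>\<delta>>0. \<forall>\<theta>>0.
    2 * sqrt 2 * exp (- \<theta>\<^sup>2 / (64 * iterlog_inv (\<delta> * \<theta>))) \<le> \<epsilon> \<or>
    (1 + ln (1 + iterlog_inv (\<delta> * \<theta>))) * (2 * sqrt 2 * exp (- (\<theta> / 2)\<^sup>2 / 64)) \<le> \<epsilon>"
proof -
  have "((\<lambda>\<theta>::real. 2 * sqrt 2 * exp (- \<theta>\<^sup>2 / 512)) \<longlongrightarrow> 0) at_top"
    by real_asymp
  then have "eventually (\<lambda>\<theta>. 2 * sqrt 2 * exp (- \<theta>\<^sup>2 / 512) < \<epsilon>) at_top"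
    using assms by (intro order_tendstoD)
  then obtain b where b: "\<And>\<theta>. b \<le> \<theta> \<Longrightarrow> 2 * sqrt 2 * exp (- \<theta>\<^sup>2 / 512) < \<epsilon>"
    by (auto simp: eventually_at_top_linorder)
  define C where "C = exp (b\<^sup>2) * exp (exp (b\<^sup>2) - 1)"
  have C: "0 < C"
    by (simp add: C_def)
  then have "((\<lambda>\<delta>::real. 2 * sqrt 2 * exp (- 1 / (64 * C * \<delta>\<^sup>2))) \<longlongrightarrow> 0) (at_right 0)"
    by real_asymp
  then have "eventually (\<lambda>\<delta>. 2 * sqrt 2 * exp (- 1 / (64 * C * \<delta>\<^sup>2)) < \<epsilon>) (at_right 0)"
    using assms by (intro order_tendstoD)
  moreover have "eventually (\<lambda>\<delta>::real. 0 < \<delta>) (at_right 0)"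
    by (rule eventually_at_right_less)
  moreover have "eventually (\<lambda>\<delta>::real. \<delta> < 1 / 32) (at_right 0)"
    by real_asymp
  ultimately have "eventually (\<lambda>\<delta>. 2 * sqrt 2 * exp (- 1 / (64 * C * \<delta>\<^sup>2)) < \<epsilon> \<and> 0 < \<delta> \<and> \<delta> < 1 / 32) (at_right 0)"
    by eventually_elim auto
  then obtain \<delta> where \<delta>: "2 * sqrt 2 * exp (- 1 / (64 * C * \<delta>\<^sup>2)) < \<epsilon>" "0 < \<delta>" "\<delta> < 1 / 32"
    using eventually_happens' trivial_limit_at_right_real by blast
  have "\<delta>\<^sup>2 \<le> (1 / 32)\<^sup>2"
    using \<delta> by (intro power_mono) auto
  then have \<delta>2: "\<delta>\<^sup>2 \<le> 1 / 512"
    by (simp add: power2_eq_square)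
  have "2 * sqrt 2 * exp (- \<theta>\<^sup>2 / (64 * iterlog_inv (\<delta> * \<theta>))) \<le> \<epsilon> \<or>
    (1 + ln (1 + iterlog_inv (\<delta> * \<theta>))) * (2 * sqrt 2 * exp (- (\<theta> / 2)\<^sup>2 / 64)) \<le> \<epsilon>" if \<theta>: "0 < \<theta>" for \<theta>
  proof (cases "b \<le> \<theta>")
    case True
    have "1 + ln (1 + iterlog_inv (\<delta> * \<theta>)) = exp (\<delta>\<^sup>2 * \<theta>\<^sup>2)"
      by (simp add: iterlog_inv_def power_mult_distrib)
    also have "\<dots> \<le> exp (\<theta>\<^sup>2 / 512)"
      using mult_right_mono[OF \<delta>2, of "\<theta>\<^sup>2"] by simp
    finally have "(1 + ln (1 + iterlog_inv (\<delta> * \<theta>))) * (2 * sqrt 2 * exp (- (\<theta> / 2)\<^sup>2 / 64))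
        \<le> exp (\<theta>\<^sup>2 / 512) * (2 * sqrt 2 * exp (- (\<theta> / 2)\<^sup>2 / 64))"
      by (intro mult_right_mono) auto
    also have "\<dots> = 2 * sqrt 2 * exp (\<theta>\<^sup>2 / 512 + - (\<theta> / 2)\<^sup>2 / 64)"
      by (simp only: exp_add mult_ac)
    also have "\<theta>\<^sup>2 / 512 + - (\<theta> / 2)\<^sup>2 / 64 = - \<theta>\<^sup>2 / 512"
      by (simp add: power_divide)
    finally show ?thesis
      using b[OF True] by linarith
  next
    case False
    have "(\<delta> * \<theta>)\<^sup>2 \<le> (1 * b)\<^sup>2"
      using False \<theta> \<delta> by (intro power_mono mult_mono) auto
    then have "iterlog_inv (\<delta> * \<theta>) \<le> (\<delta> * \<theta>)\<^sup>2 * C"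
      unfolding C_def by (intro iterlog_inv_le) simp
    then have "64 * iterlog_inv (\<delta> * \<theta>) \<le> 64 * ((\<delta> * \<theta>)\<^sup>2 * C)"
      by simp
    moreover have "0 < 64 * iterlog_inv (\<delta> * \<theta>)"
      using \<delta> \<theta> iterlog_inv_pos by simp
    ultimately have "\<theta>\<^sup>2 / (64 * ((\<delta> * \<theta>)\<^sup>2 * C)) \<le> \<theta>\<^sup>2 / (64 * iterlog_inv (\<delta> * \<theta>))"
      using C \<delta> \<theta> by (intro divide_left_mono mult_pos_pos) auto
    moreover have "\<theta>\<^sup>2 / (64 * ((\<delta> * \<theta>)\<^sup>2 * C)) = 1 / (64 * C * \<delta>\<^sup>2)"
      using \<theta> by (simp add: power_mult_distrib)
    ultimately have "exp (- \<theta>\<^sup>2 / (64 * iterlog_inv (\<delta> * \<theta>))) \<le> exp (- 1 / (64 * C * \<delta>\<^sup>2))"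
      by simp
    then have "2 * sqrt 2 * exp (- \<theta>\<^sup>2 / (64 * iterlog_inv (\<delta> * \<theta>))) \<le> 2 * sqrt 2 * exp (- 1 / (64 * C * \<delta>\<^sup>2))"
      by (intro mult_left_mono) auto
    then show ?thesis
      using \<delta>(1) by linarith
  qed
  then show ?thesis
    using \<delta>(2) by blast
qed

text \<open>
  The two alternatives are the bounds for one increment and for \<open>N\<close> increments over geometrically growing times.
  For large \<open>\<theta>\<close> there is room for \<open>(exp (4 \<theta>\<^sup>2) - exp (\<theta>\<^sup>2)) / 2\<close> increments between the two levels of the
  clock, because \<open>4 \<le> exp 2\<close>.  This is of larger order than \<open>exp ((\<theta> + 1)\<^sup>2 / 2)\<close>, and each increment violates
  its bound with probability at least a constant times \<open>exp (- (\<theta> + 1)\<^sup>2 / 2)\<close>.  For bounded \<open>\<theta>\<close> the two times are at least \<open>\<theta>\<^sup>2\<close> apart and the weights are bounded.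
\<close>

lemma lower_constants:
  fixes \<epsilon> :: real
  assumes "0 < \<epsilon>"
  shows "\<exists>\<delta>>0. \<delta> \<le> 1 / 2 \<and> (\<forall>\<theta>>0.
    \<delta> * \<theta> * (sqrt (1 + iterlog_inv \<theta>) + sqrt (1 + iterlog_inv (2 * \<theta>)))
      / sqrt (iterlog_inv (2 * \<theta>) - iterlog_inv \<theta>) \<le> \<epsilon> \<or>
    (\<exists>N. 4 ^ N * (1 + iterlog_inv \<theta>) \<le> 1 + iterlog_inv (2 * \<theta>) \<and> (1 - std_normal_density (\<theta> + 1)) ^ N \<le> \<epsilon>))"
proof -
  have "((\<lambda>\<theta>::real. exp (- (1 / sqrt (2 * pi) * exp (- (\<theta> + 1)\<^sup>2 / 2)) * ((exp (4 * \<theta>\<^sup>2) - exp (\<theta>\<^sup>2)) / 2 - 1))) \<longlongrightarrow> 0) at_top"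
    by real_asymp
  then have "eventually (\<lambda>\<theta>. exp (- std_normal_density (\<theta> + 1) * ((exp (4 * \<theta>\<^sup>2) - exp (\<theta>\<^sup>2)) / 2 - 1)) < \<epsilon>) at_top"
    using assms unfolding std_normal_density_def by (intro order_tendstoD)
  then obtain b' where b': "\<And>\<theta>. b' \<le> \<theta> \<Longrightarrow> exp (- std_normal_density (\<theta> + 1) * ((exp (4 * \<theta>\<^sup>2) - exp (\<theta>\<^sup>2)) / 2 - 1)) < \<epsilon>"
    by (auto simp: eventually_at_top_linorder)
  define R where "R = sqrt (1 + iterlog_inv (2 * b'))"
  have R: "1 \<le> R"
    using iterlog_inv_nonneg by (simp add: R_def)
  define \<delta> where "\<delta> = min (1 / 2) (\<epsilon> / (2 * R))"
  have \<delta>: "0 < \<delta>" "\<delta> \<le> 1 / 2" "2 * \<delta> * R \<le> \<epsilon>"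
  proof -
    have "\<delta> \<le> \<epsilon> / (2 * R)"
      by (simp add: \<delta>_def)
    then show "2 * \<delta> * R \<le> \<epsilon>"
      using R by (simp add: field_simps)
  qed (use assms R in \<open>auto simp: \<delta>_def\<close>)
  have "\<delta> * \<theta> * (sqrt (1 + iterlog_inv \<theta>) + sqrt (1 + iterlog_inv (2 * \<theta>)))
      / sqrt (iterlog_inv (2 * \<theta>) - iterlog_inv \<theta>) \<le> \<epsilon> \<or>
    (\<exists>N. 4 ^ N * (1 + iterlog_inv \<theta>) \<le> 1 + iterlog_inv (2 * \<theta>) \<and> (1 - std_normal_density (\<theta> + 1)) ^ N \<le> \<epsilon>)"
    if \<theta>: "0 < \<theta>" for \<theta>
  proof (cases "b' \<le> \<theta>")
    case True
    define d where "d = exp (4 * \<theta>\<^sup>2) - exp (\<theta>\<^sup>2)"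
    have "0 \<le> d"
      by (simp add: d_def)
    define N where "N = nat \<lfloor>d / 2\<rfloor>"
    have N: "real N \<le> d / 2" "d / 2 - 1 \<le> real N"
      using \<open>0 \<le> d\<close> unfolding N_def by linarith+
    have "4 \<le> exp (2::real)"
    proof -
      have "2 * 2 \<le> exp 1 * exp (1::real)"
        using exp_ge_add_one_self[of 1] by (intro mult_mono) auto
      then show ?thesis
        by (simp flip: exp_add)
    qed
    then have "4 ^ N \<le> exp (2::real) ^ N"
      by (rule power_mono) simp
    also have "\<dots> = exp (2 * real N)"
      by (rule exp_of_nat2_mult[symmetric])
    also have "\<dots> \<le> exp d"
      using N by simp
    finally have "4 ^ N * (1 + iterlog_inv \<theta>) \<le> exp d * exp (exp (\<theta>\<^sup>2) - 1)"
      by (simp add: iterlog_inv_def)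
    also have "\<dots> = 1 + iterlog_inv (2 * \<theta>)"
      by (simp add: d_def iterlog_inv_def power_mult_distrib flip: exp_add)
    finally have 1: "4 ^ N * (1 + iterlog_inv \<theta>) \<le> 1 + iterlog_inv (2 * \<theta>)" .
    define p where "p = std_normal_density (\<theta> + 1)"
    have "1 / sqrt (2 * pi) \<le> 1"
      using pi_gt3 by (simp add: divide_le_eq)
    then have "1 / sqrt (2 * pi) * exp (- (\<theta> + 1)\<^sup>2 / 2) \<le> 1 * 1"
      by (intro mult_mono) auto
    then have p: "0 \<le> p" "p \<le> 1"
      by (simp_all add: p_def std_normal_density_def)
    have "(1 - p) ^ N \<le> exp (- p) ^ N"
      using p exp_ge_add_one_self[of "- p"] by (intro power_mono) auto
    also have "\<dots> = exp (- p * real N)"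
      by (rule exp_of_nat2_mult[symmetric])
    also have "\<dots> \<le> exp (- p * (d / 2 - 1))"
      using N(2) p by (simp add: mult_left_mono)
    also have "\<dots> \<le> \<epsilon>"
      using b'[OF True] by (simp add: p_def d_def)
    finally show ?thesis
      using 1 by (auto simp: p_def)
  next
    case False
    define s u where "s = iterlog_inv \<theta>" and "u = iterlog_inv (2 * \<theta>)"
    have su: "0 \<le> s" "s \<le> u"
      using \<theta> iterlog_inv_nonneg iterlog_inv_mono[of \<theta> "2 * \<theta>"] by (auto simp: s_def u_def)
    have "u \<le> iterlog_inv (2 * b')"
      using \<theta> False unfolding u_def by (intro iterlog_inv_mono) auto
    then have uR: "sqrt (1 + u) \<le> R" "sqrt (1 + s) \<le> R"
      unfolding R_def using su by (auto intro!: real_sqrt_le_mono)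
    have sq: "\<theta>\<^sup>2 \<le> 4 * \<theta>\<^sup>2"
      by simp
    have "\<theta>\<^sup>2 \<le> 4 * \<theta>\<^sup>2 - \<theta>\<^sup>2"
      by simp
    also have "\<dots> \<le> exp (4 * \<theta>\<^sup>2) - exp (\<theta>\<^sup>2)"
      using sq by (intro exp_diff_ge) auto
    also have "\<dots> = (exp (4 * \<theta>\<^sup>2) - 1) - (exp (\<theta>\<^sup>2) - 1)"
      by simp
    also have "\<dots> \<le> exp (exp (4 * \<theta>\<^sup>2) - 1) - exp (exp (\<theta>\<^sup>2) - 1)"
      by (intro exp_diff_ge) auto
    also have "\<dots> = u - s"
      by (simp add: u_def s_def iterlog_inv_def power_mult_distrib)
    finally have gap: "\<theta> \<le> sqrt (u - s)"
      by (rule real_le_rsqrt)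
    have "\<delta> * \<theta> * (sqrt (1 + s) + sqrt (1 + u)) / sqrt (u - s) \<le> \<delta> * \<theta> * (R + R) / \<theta>"
      using uR gap \<theta> \<delta> su R by (intro frac_le mult_left_mono add_mono) (auto intro!: mult_nonneg_nonneg)
    also have "\<dots> = 2 * \<delta> * R"
      using \<theta> by simp
    finally show ?thesis
      using \<delta>(3) by (simp add: s_def u_def)
  qed
  then show ?thesis
    using \<delta> by blast
qed

section \<open>Good-lambda inequalities for the two clocks\<close>

lemma sqrt_clock:
  assumes "0 < x"
  shows "extend sqrt t \<le> ennreal x \<longleftrightarrow> t \<le> ennreal (x\<^sup>2)"
proof -
  have "extend sqrt t \<le> ennreal (sqrt (x\<^sup>2)) \<longleftrightarrow> t \<le> ennreal (x\<^sup>2)"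
    by (intro extend_le_iff strict_mono_onI) auto
  then show ?thesis
    using assms by simp
qed

lemma iterlog_clock:
  assumes "0 < x"
  shows "extend iterlog t \<le> ennreal x \<longleftrightarrow> t \<le> ennreal (iterlog_inv x)"
proof -
  have "extend iterlog t \<le> ennreal (iterlog (iterlog_inv x)) \<longleftrightarrow> t \<le> ennreal (iterlog_inv x)"
    by (intro extend_le_iff strict_mono_iterlog iterlog_nonneg iterlog_inv_nonneg)
  then show ?thesis
    using assms by (simp add: iterlog_iterlog_inv)
qed

context filtered_BM
begin

lemma unit_window:
  assumes a: "0 \<le> a" "0 < u" and E: "E \<in> sets (\<F> (ennreal a))" and D: "finite D" "D \<subseteq> {a..u}"
    and w: "\<And>t. 0 \<le> t \<Longrightarrow> 1 \<le> w t" and \<theta>: "0 < \<theta>"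
  shows "prob (E \<inter> {\<omega>\<in>space M. \<exists>t\<in>D. \<theta> / 2 * w t \<le> \<bar>B t \<omega> - B a \<omega>\<bar>})
    \<le> 2 * sqrt 2 * exp (- \<theta>\<^sup>2 / (64 * u)) * prob E"
proof -
  have "prob (E \<inter> {\<omega>\<in>space M. \<exists>t\<in>D. \<theta> / 2 * w t \<le> \<bar>B t \<omega> - B a \<omega>\<bar>})
      \<le> prob (E \<inter> {\<omega>\<in>space M. \<exists>t\<in>D. 2 * (\<theta> / 4) \<le> \<bar>B t \<omega> - B a \<omega>\<bar>})"
  proof (rule finite_measure_mono)
    have "2 * (\<theta> / 4) \<le> \<theta> / 2 * w t" if "t \<in> D" for t
      using w[of t] that D a \<theta> by auto
    then show "E \<inter> {\<omega>\<in>space M. \<exists>t\<in>D. \<theta> / 2 * w t \<le> \<bar>B t \<omega> - B a \<omega>\<bar>}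
        \<subseteq> E \<inter> {\<omega>\<in>space M. \<exists>t\<in>D. 2 * (\<theta> / 4) \<le> \<bar>B t \<omega> - B a \<omega>\<bar>}"
      by (blast intro: order_trans)
    show "E \<inter> {\<omega>\<in>space M. \<exists>t\<in>D. 2 * (\<theta> / 4) \<le> \<bar>B t \<omega> - B a \<omega>\<bar>} \<in> events"
      using D a by (intro window_event[OF a(1) E]) auto
  qed
  also have "\<dots> \<le> 2 * sqrt 2 * exp (- (\<theta> / 4)\<^sup>2 / (4 * (a + u - a))) * prob E"
    using a D \<theta> by (intro window_maximal_inequality E) auto
  also have "- (\<theta> / 4)\<^sup>2 / (4 * (a + u - a)) = - \<theta>\<^sup>2 / (64 * u)"
    by (simp add: power_divide)
  finally show ?thesis .
qed

text \<open>
  By Brownian scaling the bound of the window of length \<open>\<delta>\<^sup>2 \<theta>\<^sup>2\<close> does not depend on \<open>\<theta>\<close>.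
  The quotient by \<open>1\<close> is the weight of the unweighted maximum.
\<close>

lemma good_lambda_max_sqrt:
  "good_lambda M {\<tau>. stopping_time \<F> \<tau>}
    (\<lambda>\<tau> \<omega>. running_max (\<lambda>t. \<bar>B t \<omega>\<bar> / 1) (\<tau> \<omega>)) (\<lambda>\<tau> \<omega>. extend sqrt (\<tau> \<omega>))"
  unfolding good_lambda_def
proof (intro allI impI)
  fix \<epsilon> :: real assume \<epsilon>: "0 < \<epsilon>"
  have "((\<lambda>\<delta>::real. 2 * sqrt 2 * exp (- 1 / (64 * \<delta>\<^sup>2))) \<longlongrightarrow> 0) (at_right 0)"
    by real_asymp
  then have "eventually (\<lambda>\<delta>. 2 * sqrt 2 * exp (- 1 / (64 * \<delta>\<^sup>2)) < \<epsilon>) (at_right 0)"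
    using \<epsilon> by (intro order_tendstoD)
  moreover have "eventually (\<lambda>\<delta>::real. 0 < \<delta>) (at_right 0)"
    by (rule eventually_at_right_less)
  ultimately have "eventually (\<lambda>\<delta>. 2 * sqrt 2 * exp (- 1 / (64 * \<delta>\<^sup>2)) < \<epsilon> \<and> 0 < \<delta>) (at_right 0)"
    by eventually_elim auto
  then obtain \<delta> where \<delta>: "2 * sqrt 2 * exp (- 1 / (64 * \<delta>\<^sup>2)) < \<epsilon>" "0 < \<delta>"
    using eventually_happens' trivial_limit_at_right_real by blast
  show "\<exists>\<delta>>0. \<forall>\<tau>\<in>{\<tau>. stopping_time \<F> \<tau>}. \<forall>\<theta>>0.
     prob {\<omega>\<in>space M. ennreal (2 * \<theta>) < running_max (\<lambda>t. \<bar>B t \<omega>\<bar> / 1) (\<tau> \<omega>) \<and> extend sqrt (\<tau> \<omega>) \<le> ennreal (\<delta> * \<theta>)}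
       \<le> \<epsilon> * prob {\<omega>\<in>space M. ennreal \<theta> \<le> running_max (\<lambda>t. \<bar>B t \<omega>\<bar> / 1) (\<tau> \<omega>)}"
  proof (intro exI[of _ \<delta>] conjI \<delta>(2) ballI allI impI)
    fix \<tau> :: "'a \<Rightarrow> ennreal" and \<theta> :: real
    assume "\<tau> \<in> {\<tau>. stopping_time \<F> \<tau>}" and \<theta>: "0 < \<theta>"
    then have \<tau>: "stopping_time \<F> \<tau>" by simp
    define u where "u = (\<delta> * \<theta>)\<^sup>2"
    have u: "0 < u"
      using \<delta> \<theta> by (simp add: u_def)
    have clock: "extend sqrt t \<le> ennreal (\<delta> * \<theta>) \<longleftrightarrow> t \<le> ennreal u" for t
      unfolding u_def by (rule sqrt_clock) (use \<delta> \<theta> in simp)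
    have "- \<theta>\<^sup>2 / (64 * u) = - 1 / (64 * \<delta>\<^sup>2)"
      using \<theta> by (simp add: u_def power_mult_distrib)
    then have small: "2 * sqrt 2 * exp (- \<theta>\<^sup>2 / (64 * u)) \<le> \<epsilon>"
      using \<delta> by simp
    show "prob {\<omega>\<in>space M. ennreal (2 * \<theta>) < running_max (\<lambda>t. \<bar>B t \<omega>\<bar> / 1) (\<tau> \<omega>) \<and> extend sqrt (\<tau> \<omega>) \<le> ennreal (\<delta> * \<theta>)}
       \<le> \<epsilon> * prob {\<omega>\<in>space M. ennreal \<theta> \<le> running_max (\<lambda>t. \<bar>B t \<omega>\<bar> / 1) (\<tau> \<omega>)}"
      unfolding clock
    proof (rule upper_good_lambda[OF \<tau>, where w = "\<lambda>_. 1"])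
      fix a E D
      assume *: "0 \<le> a" "a \<le> u" "E \<in> sets (\<F> (ennreal a))" "finite D" "D \<subseteq> {a..u}"
      have "prob (E \<inter> {\<omega>\<in>space M. \<exists>t\<in>D. \<theta> / 2 * 1 \<le> \<bar>B t \<omega> - B a \<omega>\<bar>})
          \<le> 2 * sqrt 2 * exp (- \<theta>\<^sup>2 / (64 * u)) * prob E"
        by (rule unit_window[OF *(1) u *(3-5) _ \<theta>]) simp
      also have "\<dots> \<le> \<epsilon> * prob E"
        using small by (rule mult_right_mono) simp
      finally show "prob (E \<inter> {\<omega>\<in>space M. \<exists>t\<in>D. \<theta> / 2 * 1 \<le> \<bar>B t \<omega> - B a \<omega>\<bar>}) \<le> \<epsilon> * prob E" .
    qed (use u \<theta> \<epsilon> in \<open>auto intro!: mono_onI\<close>)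
  qed
qed

lemma good_lambda_sqrt_max:
  "good_lambda M {\<tau>. stopping_time \<F> \<tau>}
    (\<lambda>\<tau> \<omega>. extend sqrt (\<tau> \<omega>)) (\<lambda>\<tau> \<omega>. running_max (\<lambda>t. \<bar>B t \<omega>\<bar> / 1) (\<tau> \<omega>))"
  unfolding good_lambda_def
proof (intro allI impI)
  fix \<epsilon> :: real assume \<epsilon>: "0 < \<epsilon>"
  show "\<exists>\<delta>>0. \<forall>\<tau>\<in>{\<tau>. stopping_time \<F> \<tau>}. \<forall>\<theta>>0.
     prob {\<omega>\<in>space M. ennreal (2 * \<theta>) < extend sqrt (\<tau> \<omega>) \<and> running_max (\<lambda>t. \<bar>B t \<omega>\<bar> / 1) (\<tau> \<omega>) \<le> ennreal (\<delta> * \<theta>)}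
       \<le> \<epsilon> * prob {\<omega>\<in>space M. ennreal \<theta> \<le> extend sqrt (\<tau> \<omega>)}"
  proof (intro exI[of _ "\<epsilon> / 2"] conjI ballI allI impI)
    fix \<tau> :: "'a \<Rightarrow> ennreal" and \<theta> :: real
    assume "\<tau> \<in> {\<tau>. stopping_time \<F> \<tau>}" and \<theta>: "0 < \<theta>"
    then have \<tau>: "stopping_time \<F> \<tau>" by simp
    have [measurable]: "\<tau> \<in> borel_measurable M"
      by (rule stopping_time_measurable[OF \<tau>])
    have [measurable]: "extend sqrt \<in> borel_measurable borel"
      by (intro borel_measurable_extend continuous_intros)
    have clock: "ennreal x < extend sqrt t \<longleftrightarrow> ennreal (x\<^sup>2) < t" if "0 < x" for t x
      using sqrt_clock[OF that, of t] by (simp flip: not_le)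
    have clock2: "ennreal (2 * \<theta>) < extend sqrt t \<longleftrightarrow> ennreal ((2 * \<theta>)\<^sup>2) < t" for t
      by (rule clock) (use \<theta> in simp)
    have "1 * \<theta> \<le> sqrt 3 * \<theta>"
      using \<theta> by (intro mult_right_mono) auto
    moreover have "(2 * \<theta>)\<^sup>2 - \<theta>\<^sup>2 = 3 * \<theta>\<^sup>2"
      by (simp add: power_mult_distrib)
    then have "sqrt ((2 * \<theta>)\<^sup>2 - \<theta>\<^sup>2) = sqrt 3 * \<theta>"
      using \<theta> by (simp add: real_sqrt_mult)
    ultimately have "\<theta> \<le> sqrt ((2 * \<theta>)\<^sup>2 - \<theta>\<^sup>2)"
      by simp
    then have "\<epsilon> / 2 * \<theta> * (1 + 1) / sqrt ((2 * \<theta>)\<^sup>2 - \<theta>\<^sup>2) \<le> \<epsilon> / 2 * \<theta> * (1 + 1) / \<theta>"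
      using \<theta> \<epsilon> by (intro divide_left_mono) auto
    then have small: "\<epsilon> / 2 * \<theta> * (1 + 1) / sqrt ((2 * \<theta>)\<^sup>2 - \<theta>\<^sup>2) \<le> \<epsilon>"
      using \<theta> by simp
    have "prob {\<omega>\<in>space M. ennreal ((2 * \<theta>)\<^sup>2) < \<tau> \<omega> \<and> running_max (\<lambda>t. \<bar>B t \<omega>\<bar> / 1) (\<tau> \<omega>) \<le> ennreal (\<epsilon> / 2 * \<theta>)}
        \<le> (\<epsilon> / 2 * \<theta> * (1 + 1) / sqrt ((2 * \<theta>)\<^sup>2 - \<theta>\<^sup>2)) * prob {\<omega>\<in>space M. ennreal (\<theta>\<^sup>2) < \<tau> \<omega>}"
      by (rule lower_good_lambda_single[OF \<tau>, where w = "\<lambda>_. 1"])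
         (use \<theta> \<epsilon> in \<open>simp_all add: power_mult_distrib\<close>)
    also have "\<dots> \<le> \<epsilon> * prob {\<omega>\<in>space M. ennreal (\<theta>\<^sup>2) < \<tau> \<omega>}"
      using small by (rule mult_right_mono) simp
    also have "\<dots> \<le> \<epsilon> * prob {\<omega>\<in>space M. ennreal \<theta> \<le> extend sqrt (\<tau> \<omega>)}"
    proof (intro mult_left_mono finite_measure_mono)
      show "{\<omega>\<in>space M. ennreal (\<theta>\<^sup>2) < \<tau> \<omega>} \<subseteq> {\<omega>\<in>space M. ennreal \<theta> \<le> extend sqrt (\<tau> \<omega>)}"
        unfolding clock[OF \<theta>, symmetric] by (intro Collect_mono impI) (blast intro: less_imp_le)
    qed (use \<epsilon> in auto)
    finally show "prob {\<omega>\<in>space M. ennreal (2 * \<theta>) < extend sqrt (\<tau> \<omega>) \<and> running_max (\<lambda>t. \<bar>B t \<omega>\<bar> / 1) (\<tau> \<omega>) \<le> ennreal (\<epsilon> / 2 * \<theta>)}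
       \<le> \<epsilon> * prob {\<omega>\<in>space M. ennreal \<theta> \<le> extend sqrt (\<tau> \<omega>)}"
      by (simp only: clock2)
  qed (use \<epsilon> in simp)
qed

lemma good_lambda_max_iterlog:
  "good_lambda M {\<tau>. stopping_time \<F> \<tau>}
    (\<lambda>\<tau> \<omega>. running_max (\<lambda>t. \<bar>B t \<omega>\<bar> / sqrt (1 + t)) (\<tau> \<omega>)) (\<lambda>\<tau> \<omega>. extend iterlog (\<tau> \<omega>))"
  unfolding good_lambda_def
proof (intro allI impI)
  fix \<epsilon> :: real assume \<epsilon>: "0 < \<epsilon>"
  obtain \<delta> where \<delta>: "0 < \<delta>" and choice: "\<And>\<theta>. 0 < \<theta> \<Longrightarrow>
      2 * sqrt 2 * exp (- \<theta>\<^sup>2 / (64 * iterlog_inv (\<delta> * \<theta>))) \<le> \<epsilon> \<or>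
      (1 + ln (1 + iterlog_inv (\<delta> * \<theta>))) * (2 * sqrt 2 * exp (- (\<theta> / 2)\<^sup>2 / 64)) \<le> \<epsilon>"
    using upper_constants[OF \<epsilon>] by blast
  show "\<exists>\<delta>>0. \<forall>\<tau>\<in>{\<tau>. stopping_time \<F> \<tau>}. \<forall>\<theta>>0.
     prob {\<omega>\<in>space M. ennreal (2 * \<theta>) < running_max (\<lambda>t. \<bar>B t \<omega>\<bar> / sqrt (1 + t)) (\<tau> \<omega>) \<and> extend iterlog (\<tau> \<omega>) \<le> ennreal (\<delta> * \<theta>)}
       \<le> \<epsilon> * prob {\<omega>\<in>space M. ennreal \<theta> \<le> running_max (\<lambda>t. \<bar>B t \<omega>\<bar> / sqrt (1 + t)) (\<tau> \<omega>)}"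
  proof (intro exI[of _ \<delta>] conjI \<delta> ballI allI impI)
    fix \<tau> :: "'a \<Rightarrow> ennreal" and \<theta> :: real
    assume "\<tau> \<in> {\<tau>. stopping_time \<F> \<tau>}" and \<theta>: "0 < \<theta>"
    then have \<tau>: "stopping_time \<F> \<tau>" by simp
    define u where "u = iterlog_inv (\<delta> * \<theta>)"
    have u: "0 < u"
      using \<delta> \<theta> by (simp add: u_def iterlog_inv_pos)
    have clock: "extend iterlog t \<le> ennreal (\<delta> * \<theta>) \<longleftrightarrow> t \<le> ennreal u" for t
      unfolding u_def by (rule iterlog_clock) (use \<delta> \<theta> in simp)
    show "prob {\<omega>\<in>space M. ennreal (2 * \<theta>) < running_max (\<lambda>t. \<bar>B t \<omega>\<bar> / sqrt (1 + t)) (\<tau> \<omega>) \<and> extend iterlog (\<tau> \<omega>) \<le> ennreal (\<delta> * \<theta>)}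
       \<le> \<epsilon> * prob {\<omega>\<in>space M. ennreal \<theta> \<le> running_max (\<lambda>t. \<bar>B t \<omega>\<bar> / sqrt (1 + t)) (\<tau> \<omega>)}"
      unfolding clock
    proof (rule upper_good_lambda[OF \<tau>, where w = "\<lambda>t. sqrt (1 + t)"])
      fix a E D
      assume *: "0 \<le> a" "a \<le> u" "E \<in> sets (\<F> (ennreal a))" "finite D" "D \<subseteq> {a..u}"
      let ?P = "prob (E \<inter> {\<omega>\<in>space M. \<exists>t\<in>D. \<theta> / 2 * sqrt (1 + t) \<le> \<bar>B t \<omega> - B a \<omega>\<bar>})"
      have "?P \<le> 2 * sqrt 2 * exp (- \<theta>\<^sup>2 / (64 * u)) * prob E"
        by (rule unit_window[OF *(1) u *(3-5) _ \<theta>]) simp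
      moreover have "?P \<le> (1 + ln (1 + u)) * (2 * sqrt 2 * exp (- (\<theta> / 2)\<^sup>2 / 64)) * prob E"
        by (rule weighted_window_maximal_inequality[OF *]) (use \<theta> in simp)
      ultimately show "?P \<le> \<epsilon> * prob E"
        using choice[OF \<theta>, folded u_def]
        by (elim disjE) (erule (1) order_trans[OF _ mult_right_mono[OF _ measure_nonneg]])+
    qed (use u \<theta> \<epsilon> in \<open>auto intro!: mono_onI continuous_intros\<close>)
  qed
qed

lemma good_lambda_iterlog_max:
  "good_lambda M {\<tau>. stopping_time \<F> \<tau>}
    (\<lambda>\<tau> \<omega>. extend iterlog (\<tau> \<omega>)) (\<lambda>\<tau> \<omega>. running_max (\<lambda>t. \<bar>B t \<omega>\<bar> / sqrt (1 + t)) (\<tau> \<omega>))"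
  unfolding good_lambda_def
proof (intro allI impI)
  fix \<epsilon> :: real assume \<epsilon>: "0 < \<epsilon>"
  obtain \<delta> where \<delta>: "0 < \<delta>" "\<delta> \<le> 1 / 2" and choice: "\<And>\<theta>. 0 < \<theta> \<Longrightarrow>
    \<delta> * \<theta> * (sqrt (1 + iterlog_inv \<theta>) + sqrt (1 + iterlog_inv (2 * \<theta>)))
      / sqrt (iterlog_inv (2 * \<theta>) - iterlog_inv \<theta>) \<le> \<epsilon> \<or>
    (\<exists>N. 4 ^ N * (1 + iterlog_inv \<theta>) \<le> 1 + iterlog_inv (2 * \<theta>) \<and> (1 - std_normal_density (\<theta> + 1)) ^ N \<le> \<epsilon>)"
    using lower_constants[OF \<epsilon>] by blast
  show "\<exists>\<delta>>0. \<forall>\<tau>\<in>{\<tau>. stopping_time \<F> \<tau>}. \<forall>\<theta>>0.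
     prob {\<omega>\<in>space M. ennreal (2 * \<theta>) < extend iterlog (\<tau> \<omega>) \<and> running_max (\<lambda>t. \<bar>B t \<omega>\<bar> / sqrt (1 + t)) (\<tau> \<omega>) \<le> ennreal (\<delta> * \<theta>)}
       \<le> \<epsilon> * prob {\<omega>\<in>space M. ennreal \<theta> \<le> extend iterlog (\<tau> \<omega>)}"
  proof (intro exI[of _ \<delta>] conjI \<delta> ballI allI impI)
    fix \<tau> :: "'a \<Rightarrow> ennreal" and \<theta> :: real
    assume "\<tau> \<in> {\<tau>. stopping_time \<F> \<tau>}" and \<theta>: "0 < \<theta>"
    then have \<tau>: "stopping_time \<F> \<tau>" by simp
    have [measurable]: "\<tau> \<in> borel_measurable M"
      by (rule stopping_time_measurable[OF \<tau>])
    have [measurable]: "extend iterlog \<in> borel_measurable borel"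
      by (intro borel_measurable_extend continuous_on_iterlog)
    have clock: "ennreal x < extend iterlog t \<longleftrightarrow> ennreal (iterlog_inv x) < t" if "0 < x" for t x
      using iterlog_clock[OF that, of t] by (simp flip: not_le)
    define s u where "s = iterlog_inv \<theta>" and "u = iterlog_inv (2 * \<theta>)"
    have clock2: "ennreal (2 * \<theta>) < extend iterlog t \<longleftrightarrow> ennreal u < t" for t
      unfolding u_def by (rule clock) (use \<theta> in simp)
    have s: "0 \<le> s"
      by (simp add: s_def iterlog_inv_nonneg)
    have su: "s < u"
      using \<theta> by (simp add: s_def u_def iterlog_inv_def)
    let ?S = "{\<omega>\<in>space M. ennreal u < \<tau> \<omega> \<and> running_max (\<lambda>t. \<bar>B t \<omega>\<bar> / sqrt (1 + t)) (\<tau> \<omega>) \<le> ennreal (\<delta> * \<theta>)}"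
    have "prob ?S \<le> \<epsilon> * prob {\<omega>\<in>space M. ennreal s < \<tau> \<omega>}"
      using choice[OF \<theta>, folded s_def u_def]
    proof
      assume small: "\<delta> * \<theta> * (sqrt (1 + s) + sqrt (1 + u)) / sqrt (u - s) \<le> \<epsilon>"
      have "prob ?S \<le> (\<delta> * \<theta> * (sqrt (1 + s) + sqrt (1 + u)) / sqrt (u - s)) * prob {\<omega>\<in>space M. ennreal s < \<tau> \<omega>}"
        by (rule lower_good_lambda_single[OF \<tau> s su, where w = "\<lambda>t. sqrt (1 + t)"]) (use \<theta> \<delta> in auto)
      also have "\<dots> \<le> \<epsilon> * prob {\<omega>\<in>space M. ennreal s < \<tau> \<omega>}"
        using small by (rule mult_right_mono) simp
      finally show ?thesis .
    next
      assume "\<exists>N. 4 ^ N * (1 + s) \<le> 1 + u \<and> (1 - std_normal_density (\<theta> + 1)) ^ N \<le> \<epsilon>"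
      then obtain N where N: "4 ^ N * (1 + s) \<le> 1 + u" "(1 - std_normal_density (\<theta> + 1)) ^ N \<le> \<epsilon>"
        by blast
      \<comment> \<open>Along these times the increments have standard deviation \<open>sqrt 3\<close> times the weight at their left end,
         so that the maximum below \<open>\<delta> \<theta>\<close> makes each of them at most \<open>\<theta>\<close> standard deviations once \<open>\<delta> \<le> 1 / 2\<close>.\<close>
      define t where "t j = 4 ^ j * (1 + s) - 1" for j :: nat
      have "prob ?S \<le> (1 - std_normal_density (\<theta> + 1)) ^ N * prob {\<omega>\<in>space M. ennreal (t 0) < \<tau> \<omega>}"
      proof (rule lower_good_lambda_increments[OF \<tau>, where w = "\<lambda>t. sqrt (1 + t)"])
        show "0 \<le> t 0" "t N \<le> u"
          using s N by (simp_all add: t_def)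
        show "t j < t (Suc j)" for j
          using s by (simp add: t_def)
        fix j assume "j < N"
        define r where "r = sqrt (4 ^ j * (1 + s))"
        have q: "0 \<le> r"
          using s by (simp add: r_def)
        have "t (Suc j) - t j = 3 * (4 ^ j * (1 + s))" "1 + t (Suc j) = 4 * (4 ^ j * (1 + s))" "1 + t j = 4 ^ j * (1 + s)"
          by (simp_all add: t_def algebra_simps)
        then have sq: "sqrt (t (Suc j) - t j) = sqrt 3 * r" "sqrt (1 + t (Suc j)) = 2 * r" "sqrt (1 + t j) = r"
          unfolding r_def by (simp_all only: real_sqrt_mult real_sqrt_four)
        have "3 / 2 \<le> sqrt 3"
          by (rule real_le_rsqrt) (simp add: power2_eq_square)
        then have "3 * \<delta> \<le> sqrt 3"
          using \<delta> by linarith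
        then have "3 * \<delta> * (\<theta> * r) \<le> sqrt 3 * (\<theta> * r)"
          using \<theta> q by (intro mult_right_mono) auto
        also have "3 * \<delta> * (\<theta> * r) = \<delta> * \<theta> * (sqrt (1 + t j) + sqrt (1 + t (Suc j)))"
          unfolding sq by simp
        also have "sqrt 3 * (\<theta> * r) = \<theta> * sqrt (t (Suc j) - t j)"
          unfolding sq by simp
        finally show "\<delta> * \<theta> * (sqrt (1 + t j) + sqrt (1 + t (Suc j))) \<le> \<theta> * sqrt (t (Suc j) - t j)" .
      qed (use \<theta> \<delta> in auto)
      also have "\<dots> \<le> \<epsilon> * prob {\<omega>\<in>space M. ennreal (t 0) < \<tau> \<omega>}"
        using N(2) by (rule mult_right_mono) simp
      finally show ?thesis
        by (simp add: t_def)
    qed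
    also have "\<dots> \<le> \<epsilon> * prob {\<omega>\<in>space M. ennreal \<theta> \<le> extend iterlog (\<tau> \<omega>)}"
    proof (intro mult_left_mono finite_measure_mono)
      show "{\<omega>\<in>space M. ennreal s < \<tau> \<omega>} \<subseteq> {\<omega>\<in>space M. ennreal \<theta> \<le> extend iterlog (\<tau> \<omega>)}"
        unfolding s_def clock[OF \<theta>, symmetric] by (intro Collect_mono impI) (blast intro: less_imp_le)
    qed (use \<epsilon> in auto)
    finally show "prob {\<omega>\<in>space M. ennreal (2 * \<theta>) < extend iterlog (\<tau> \<omega>) \<and> running_max (\<lambda>t. \<bar>B t \<omega>\<bar> / sqrt (1 + t)) (\<tau> \<omega>) \<le> ennreal (\<delta> * \<theta>)}
       \<le> \<epsilon> * prob {\<omega>\<in>space M. ennreal \<theta> \<le> extend iterlog (\<tau> \<omega>)}"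
      by (simp only: clock2)
  qed
qed

end

section \<open>The planar Brownian motion\<close>

lemma running_max_complex_le:
  assumes w: "\<And>t. 0 \<le> t \<Longrightarrow> 0 < w t"
  shows "running_max (\<lambda>t. cmod (z t) / w t) \<tau>
    \<le> ennreal 2 * max (running_max (\<lambda>t. \<bar>Re (z t)\<bar> / w t) \<tau>) (running_max (\<lambda>t. \<bar>Im (z t)\<bar> / w t) \<tau>)"
  (is "_ \<le> ennreal 2 * max ?R ?I")
  unfolding running_max_def[of "\<lambda>t. cmod (z t) / w t"]
proof (rule SUP_least)
  fix t assume "t \<in> {t. 0 \<le> t \<and> ennreal t \<le> \<tau>}"
  then have t: "0 \<le> t" "ennreal t \<le> \<tau>"
    by auto
  let ?a = "\<bar>Re (z t)\<bar> / w t" and ?b = "\<bar>Im (z t)\<bar> / w t"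
  have "cmod (z t) / w t \<le> (\<bar>Re (z t)\<bar> + \<bar>Im (z t)\<bar>) / w t"
    using w[OF t(1)] by (intro divide_right_mono cmod_le) auto
  also have "\<dots> \<le> 2 * max ?a ?b"
    by (simp add: add_divide_distrib)
  finally have "ennreal (cmod (z t) / w t) \<le> ennreal (2 * max ?a ?b)"
    by (rule ennreal_leI)
  also have "\<dots> = ennreal 2 * ennreal (max ?a ?b)"
    by (rule ennreal_mult') simp
  also have "ennreal (max ?a ?b) \<le> max ?R ?I"
    using le_running_max[OF t, of "\<lambda>t. \<bar>Re (z t)\<bar> / w t"] le_running_max[OF t, of "\<lambda>t. \<bar>Im (z t)\<bar> / w t"]
    by (auto simp: max_def le_max_iff_disj)
  finally show "ennreal (cmod (z t) / w t) \<le> ennreal 2 * max ?R ?I"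
    by (simp add: mult_left_mono)
qed

text \<open>
  The one-dimensional comparison transfers to the plane because the maximum of the modulus lies between that of
  the real part and twice the larger one of the maxima of the two parts.
\<close>

lemma complex_BM_moderate_comparison:
  fixes M :: "'a measure" and W :: "real \<Rightarrow> 'a \<Rightarrow> complex"
  assumes M: "prob_space M" and usual: "usual_conditions M \<F>" and W: "complex_standard_BM M \<F> W"
    and F: "moderate F"
    and w: "continuous_on {0..} w" "\<And>t. 0 \<le> t \<Longrightarrow> 1 \<le> w t"
    and g: "continuous_on {0..} g"
    and upper: "\<And>B. filtered_BM M \<F> B \<Longrightarrow> good_lambda M {\<tau>. stopping_time \<F> \<tau>}
      (\<lambda>\<tau> \<omega>. running_max (\<lambda>t. \<bar>B t \<omega>\<bar> / w t) (\<tau> \<omega>)) (\<lambda>\<tau> \<omega>. extend g (\<tau> \<omega>))"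
    and lower: "\<And>B. filtered_BM M \<F> B \<Longrightarrow> good_lambda M {\<tau>. stopping_time \<F> \<tau>}
      (\<lambda>\<tau> \<omega>. extend g (\<tau> \<omega>)) (\<lambda>\<tau> \<omega>. running_max (\<lambda>t. \<bar>B t \<omega>\<bar> / w t) (\<tau> \<omega>))"
  shows "\<exists>c>0. \<exists>C>0. \<forall>\<tau>. stopping_time \<F> \<tau> \<longrightarrow>
    ennreal c * (\<integral>\<^sup>+\<omega>. extend F (extend g (\<tau> \<omega>)) \<partial>M)
      \<le> (\<integral>\<^sup>+\<omega>. extend F (running_max (\<lambda>t. cmod (W t \<omega>) / w t) (\<tau> \<omega>)) \<partial>M) \<and>
    (\<integral>\<^sup>+\<omega>. extend F (running_max (\<lambda>t. cmod (W t \<omega>) / w t) (\<tau> \<omega>)) \<partial>M)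
      \<le> ennreal C * (\<integral>\<^sup>+\<omega>. extend F (extend g (\<tau> \<omega>)) \<partial>M)"
proof -
  have BM: "filtered_BM M \<F> (\<lambda>t \<omega>. Re (W t \<omega>))" "filtered_BM M \<F> (\<lambda>t \<omega>. Im (W t \<omega>))"
    using M usual W
    by (auto simp: filtered_BM_def filtered_BM_axioms_def usual_conditions_def complex_standard_BM_def)
  interpret R: filtered_BM M \<F> "\<lambda>t \<omega>. Re (W t \<omega>)" by fact
  interpret I: filtered_BM M \<F> "\<lambda>t \<omega>. Im (W t \<omega>)" by fact
  have Fm: "mono_on {0..} F" and Fc: "continuous_on {0..} F"
    using F by (auto simp: moderate_def)
  have [measurable]: "extend F \<in> borel_measurable borel"
    by (rule borel_measurable_extend[OF Fc])
  have wpos: "0 < w t" if "0 \<le> t" for t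
    using w(2)[OF that] by linarith
  define X where "X \<tau> \<omega> = extend g (\<tau> \<omega>)" for \<tau> :: "'a \<Rightarrow> ennreal" and \<omega>
  define YR where "YR \<tau> \<omega> = running_max (\<lambda>t. \<bar>Re (W t \<omega>)\<bar> / w t) (\<tau> \<omega>)" for \<tau> :: "'a \<Rightarrow> ennreal" and \<omega>
  define YI where "YI \<tau> \<omega> = running_max (\<lambda>t. \<bar>Im (W t \<omega>)\<bar> / w t) (\<tau> \<omega>)" for \<tau> :: "'a \<Rightarrow> ennreal" and \<omega>
  define Y where "Y \<tau> \<omega> = running_max (\<lambda>t. cmod (W t \<omega>) / w t) (\<tau> \<omega>)" for \<tau> :: "'a \<Rightarrow> ennreal" and \<omega>
  have measX: "X \<tau> \<in> borel_measurable M" if "stopping_time \<F> \<tau>" for \<tau>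
    unfolding X_def
    by (rule measurable_compose[OF R.stopping_time_measurable[OF that] borel_measurable_extend[OF g]])
  have measR: "YR \<tau> \<in> borel_measurable M" if "stopping_time \<F> \<tau>" for \<tau>
    unfolding YR_def by (rule R.running_max_measurable[OF that w])
  have measI: "YI \<tau> \<in> borel_measurable M" if "stopping_time \<F> \<tau>" for \<tau>
    unfolding YI_def by (rule I.running_max_measurable[OF that w])
  obtain A where A: "0 < A" "\<And>\<tau>. stopping_time \<F> \<tau> \<Longrightarrow>
      (\<integral>\<^sup>+\<omega>. extend F (X \<tau> \<omega>) \<partial>M) \<le> ennreal A * (\<integral>\<^sup>+\<omega>. extend F (YR \<tau> \<omega>) \<partial>M)"
    using R.good_lambda_moderate[OF F lower[OF BM(1), folded X_def YR_def]] measX measR by auto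
  obtain CR where CR: "0 < CR" "\<And>\<tau>. stopping_time \<F> \<tau> \<Longrightarrow>
      (\<integral>\<^sup>+\<omega>. extend F (YR \<tau> \<omega>) \<partial>M) \<le> ennreal CR * (\<integral>\<^sup>+\<omega>. extend F (X \<tau> \<omega>) \<partial>M)"
    using R.good_lambda_moderate[OF F upper[OF BM(1), folded X_def YR_def]] measX measR by auto
  obtain CI where CI: "0 < CI" "\<And>\<tau>. stopping_time \<F> \<tau> \<Longrightarrow>
      (\<integral>\<^sup>+\<omega>. extend F (YI \<tau> \<omega>) \<partial>M) \<le> ennreal CI * (\<integral>\<^sup>+\<omega>. extend F (X \<tau> \<omega>) \<partial>M)"
    using R.good_lambda_moderate[OF F upper[OF BM(2), folded X_def YI_def]] measX measI by auto
  obtain K where K: "1 \<le> K" "\<forall>x\<ge>0. F (2 * x) \<le> K * F x"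
    using moderate_scaling[OF F, of 2] by auto
  have low: "ennreal (1 / A) * (\<integral>\<^sup>+\<omega>. extend F (X \<tau> \<omega>) \<partial>M) \<le> (\<integral>\<^sup>+\<omega>. extend F (Y \<tau> \<omega>) \<partial>M)"
    if \<tau>: "stopping_time \<F> \<tau>" for \<tau>
  proof -
    have "YR \<tau> \<omega> \<le> Y \<tau> \<omega>" for \<omega>
      unfolding YR_def Y_def
      by (intro running_max_mono divide_right_mono abs_Re_le_cmod less_imp_le[OF wpos])
    then have "(\<integral>\<^sup>+\<omega>. extend F (YR \<tau> \<omega>) \<partial>M) \<le> (\<integral>\<^sup>+\<omega>. extend F (Y \<tau> \<omega>) \<partial>M)"
      by (intro nn_integral_mono extend_mono[OF Fm])
    then have "(\<integral>\<^sup>+\<omega>. extend F (X \<tau> \<omega>) \<partial>M) \<le> ennreal A * (\<integral>\<^sup>+\<omega>. extend F (Y \<tau> \<omega>) \<partial>M)"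
      using A(2)[OF \<tau>] by (meson mult_left_mono order_trans zero_le)
    then have "ennreal (1 / A) * (\<integral>\<^sup>+\<omega>. extend F (X \<tau> \<omega>) \<partial>M)
        \<le> ennreal (1 / A) * (ennreal A * (\<integral>\<^sup>+\<omega>. extend F (Y \<tau> \<omega>) \<partial>M))"
      by (rule mult_left_mono) simp
    also have "\<dots> = ennreal (1 / A * A) * (\<integral>\<^sup>+\<omega>. extend F (Y \<tau> \<omega>) \<partial>M)"
      using A(1) by (subst ennreal_mult) (auto simp: mult.assoc)
    also have "1 / A * A = 1"
      using A(1) by simp
    finally show ?thesis
      by simp
  qed
  have up: "(\<integral>\<^sup>+\<omega>. extend F (Y \<tau> \<omega>) \<partial>M) \<le> ennreal (K * (CR + CI)) * (\<integral>\<^sup>+\<omega>. extend F (X \<tau> \<omega>) \<partial>M)"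
    if \<tau>: "stopping_time \<F> \<tau>" for \<tau>
  proof -
    note [measurable] = measR[OF \<tau>] measI[OF \<tau>]
    have pointwise: "extend F (Y \<tau> \<omega>) \<le> ennreal K * (extend F (YR \<tau> \<omega>) + extend F (YI \<tau> \<omega>))" for \<omega>
    proof -
      have "extend F (Y \<tau> \<omega>) \<le> extend F (ennreal 2 * max (YR \<tau> \<omega>) (YI \<tau> \<omega>))"
        unfolding Y_def YR_def YI_def by (intro extend_mono[OF Fm] running_max_complex_le wpos)
      also have "\<dots> \<le> ennreal K * extend F (max (YR \<tau> \<omega>) (YI \<tau> \<omega>))"
        by (rule extend_scaling[OF F _ K]) simp
      also have "extend F (max (YR \<tau> \<omega>) (YI \<tau> \<omega>)) \<le> extend F (YR \<tau> \<omega>) + extend F (YI \<tau> \<omega>)"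
        by (simp add: max_def add_increasing add_increasing2)
      finally show ?thesis
        by (simp add: mult_left_mono)
    qed
    have "(\<integral>\<^sup>+\<omega>. extend F (Y \<tau> \<omega>) \<partial>M) \<le> (\<integral>\<^sup>+\<omega>. ennreal K * (extend F (YR \<tau> \<omega>) + extend F (YI \<tau> \<omega>)) \<partial>M)"
      by (intro nn_integral_mono pointwise)
    also have "\<dots> = ennreal K * ((\<integral>\<^sup>+\<omega>. extend F (YR \<tau> \<omega>) \<partial>M) + (\<integral>\<^sup>+\<omega>. extend F (YI \<tau> \<omega>) \<partial>M))"
      by (simp add: nn_integral_cmult nn_integral_add)
    also have "\<dots> \<le> ennreal K * (ennreal CR * (\<integral>\<^sup>+\<omega>. extend F (X \<tau> \<omega>) \<partial>M) + ennreal CI * (\<integral>\<^sup>+\<omega>. extend F (X \<tau> \<omega>) \<partial>M))"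
      using CR(2)[OF \<tau>] CI(2)[OF \<tau>] by (intro mult_left_mono add_mono) auto
    also have "\<dots> = ennreal (K * (CR + CI)) * (\<integral>\<^sup>+\<omega>. extend F (X \<tau> \<omega>) \<partial>M)"
      using CR(1) CI(1) K(1) by (simp add: ennreal_mult ennreal_plus distrib_right mult.assoc)
    finally show ?thesis .
  qed
  have "0 < 1 / A" "0 < K * (CR + CI)"
    using A(1) CR(1) CI(1) K(1) by auto
  with low up show ?thesis
    unfolding X_def Y_def by blast
qed

theorem corollary8p2:
  fixes M :: "'a measure"
    and \<F> :: "ennreal \<Rightarrow> 'a measure"
    and W :: "real \<Rightarrow> 'a \<Rightarrow> complex"
  assumes "prob_space M"
    and "usual_conditions M \<F>"
    and "complex_standard_BM M \<F> W"
  shows "\<forall>F. moderate F \<longrightarrow>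
    (\<exists>c C :: real. c > 0 \<and> C > 0 \<and>
      (\<forall>\<tau>. stopping_time \<F> \<tau> \<longrightarrow>
        ennreal c * (\<integral>\<^sup>+ \<omega>. extend F (extend sqrt (\<tau> \<omega>)) \<partial>M)
          \<le> (\<integral>\<^sup>+ \<omega>. extend F (running_max (\<lambda>t. cmod (W t \<omega>)) (\<tau> \<omega>)) \<partial>M) \<and>
        (\<integral>\<^sup>+ \<omega>. extend F (running_max (\<lambda>t. cmod (W t \<omega>)) (\<tau> \<omega>)) \<partial>M)
          \<le> ennreal C * (\<integral>\<^sup>+ \<omega>. extend F (extend sqrt (\<tau> \<omega>)) \<partial>M) \<and>
        ennreal c * (\<integral>\<^sup>+ \<omega>. extend F (extend (\<lambda>t. sqrt (ln (1 + ln (1 + t)))) (\<tau> \<omega>)) \<partial>M)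
          \<le> (\<integral>\<^sup>+ \<omega>. extend F (running_max (\<lambda>t. cmod (W t \<omega>) / sqrt (1 + t)) (\<tau> \<omega>)) \<partial>M) \<and>
        (\<integral>\<^sup>+ \<omega>. extend F (running_max (\<lambda>t. cmod (W t \<omega>) / sqrt (1 + t)) (\<tau> \<omega>)) \<partial>M)
          \<le> ennreal C * (\<integral>\<^sup>+ \<omega>. extend F (extend (\<lambda>t. sqrt (ln (1 + ln (1 + t)))) (\<tau> \<omega>)) \<partial>M)))"
proof (intro allI impI)
  fix F assume F: "moderate F"
  have iterlog: "iterlog = (\<lambda>t. sqrt (ln (1 + ln (1 + t))))"
    by (simp add: fun_eq_iff iterlog_def)
  have "continuous_on {0..} sqrt" "continuous_on {0..} (\<lambda>t. sqrt (1 + t))"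
    by (intro continuous_intros)+
  note cont = this
  obtain c1 C1 where 1: "0 < c1" "0 < C1" "\<And>\<tau>. stopping_time \<F> \<tau> \<Longrightarrow>
      ennreal c1 * (\<integral>\<^sup>+\<omega>. extend F (extend sqrt (\<tau> \<omega>)) \<partial>M)
        \<le> (\<integral>\<^sup>+\<omega>. extend F (running_max (\<lambda>t. cmod (W t \<omega>) / 1) (\<tau> \<omega>)) \<partial>M) \<and>
      (\<integral>\<^sup>+\<omega>. extend F (running_max (\<lambda>t. cmod (W t \<omega>) / 1) (\<tau> \<omega>)) \<partial>M)
        \<le> ennreal C1 * (\<integral>\<^sup>+\<omega>. extend F (extend sqrt (\<tau> \<omega>)) \<partial>M)"
    using complex_BM_moderate_comparison[OF assms F, of "\<lambda>_. 1" sqrt,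
        OF continuous_on_const order_refl cont(1) filtered_BM.good_lambda_max_sqrt filtered_BM.good_lambda_sqrt_max]
    by blast
  obtain c2 C2 where 2: "0 < c2" "0 < C2" "\<And>\<tau>. stopping_time \<F> \<tau> \<Longrightarrow>
      ennreal c2 * (\<integral>\<^sup>+\<omega>. extend F (extend iterlog (\<tau> \<omega>)) \<partial>M)
        \<le> (\<integral>\<^sup>+\<omega>. extend F (running_max (\<lambda>t. cmod (W t \<omega>) / sqrt (1 + t)) (\<tau> \<omega>)) \<partial>M) \<and>
      (\<integral>\<^sup>+\<omega>. extend F (running_max (\<lambda>t. cmod (W t \<omega>) / sqrt (1 + t)) (\<tau> \<omega>)) \<partial>M)
        \<le> ennreal C2 * (\<integral>\<^sup>+\<omega>. extend F (extend iterlog (\<tau> \<omega>)) \<partial>M)"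
    using complex_BM_moderate_comparison[OF assms F, of "\<lambda>t. sqrt (1 + t)" iterlog,
        OF cont(2) _ continuous_on_iterlog filtered_BM.good_lambda_max_iterlog filtered_BM.good_lambda_iterlog_max]
    by auto
  have shrink: "ennreal (min c1 c2) * x \<le> y" if "ennreal c1 * x \<le> y \<or> ennreal c2 * x \<le> y" for x y
  proof -
    have "ennreal (min c1 c2) * x \<le> ennreal c1 * x" "ennreal (min c1 c2) * x \<le> ennreal c2 * x"
      by (intro mult_right_mono ennreal_leI; simp)+
    then show ?thesis
      using that order_trans by blast
  qed
  have enlarge: "x \<le> ennreal (max C1 C2) * y" if "x \<le> ennreal C1 * y \<or> x \<le> ennreal C2 * y" for x y
  proof -
    have "ennreal C1 * y \<le> ennreal (max C1 C2) * y" "ennreal C2 * y \<le> ennreal (max C1 C2) * y"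
      by (intro mult_right_mono ennreal_leI; simp)+
    then show ?thesis
      using that order_trans by blast
  qed
  show "\<exists>c C :: real. c > 0 \<and> C > 0 \<and>
      (\<forall>\<tau>. stopping_time \<F> \<tau> \<longrightarrow>
        ennreal c * (\<integral>\<^sup>+ \<omega>. extend F (extend sqrt (\<tau> \<omega>)) \<partial>M)
          \<le> (\<integral>\<^sup>+ \<omega>. extend F (running_max (\<lambda>t. cmod (W t \<omega>)) (\<tau> \<omega>)) \<partial>M) \<and>
        (\<integral>\<^sup>+ \<omega>. extend F (running_max (\<lambda>t. cmod (W t \<omega>)) (\<tau> \<omega>)) \<partial>M)
          \<le> ennreal C * (\<integral>\<^sup>+ \<omega>. extend F (extend sqrt (\<tau> \<omega>)) \<partial>M) \<and>
        ennreal c * (\<integral>\<^sup>+ \<omega>. extend F (extend (\<lambda>t. sqrt (ln (1 + ln (1 + t)))) (\<tau> \<omega>)) \<partial>M)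
          \<le> (\<integral>\<^sup>+ \<omega>. extend F (running_max (\<lambda>t. cmod (W t \<omega>) / sqrt (1 + t)) (\<tau> \<omega>)) \<partial>M) \<and>
        (\<integral>\<^sup>+ \<omega>. extend F (running_max (\<lambda>t. cmod (W t \<omega>) / sqrt (1 + t)) (\<tau> \<omega>)) \<partial>M)
          \<le> ennreal C * (\<integral>\<^sup>+ \<omega>. extend F (extend (\<lambda>t. sqrt (ln (1 + ln (1 + t)))) (\<tau> \<omega>)) \<partial>M))"
  proof (rule exI[of _ "min c1 c2"], rule exI[of _ "max C1 C2"], intro conjI allI impI)
    fix \<tau> :: "'a \<Rightarrow> ennreal" assume \<tau>: "stopping_time \<F> \<tau>"
    note bound1 = 1(3)[OF \<tau>, unfolded div_by_1] and bound2 = 2(3)[OF \<tau>, unfolded iterlog]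
    show "ennreal (min c1 c2) * (\<integral>\<^sup>+ \<omega>. extend F (extend sqrt (\<tau> \<omega>)) \<partial>M)
          \<le> (\<integral>\<^sup>+ \<omega>. extend F (running_max (\<lambda>t. cmod (W t \<omega>)) (\<tau> \<omega>)) \<partial>M)"
      using bound1 by (intro shrink) blast
    show "(\<integral>\<^sup>+ \<omega>. extend F (running_max (\<lambda>t. cmod (W t \<omega>)) (\<tau> \<omega>)) \<partial>M)
          \<le> ennreal (max C1 C2) * (\<integral>\<^sup>+ \<omega>. extend F (extend sqrt (\<tau> \<omega>)) \<partial>M)"
      using bound1 by (intro enlarge) blast
    show "ennreal (min c1 c2) * (\<integral>\<^sup>+ \<omega>. extend F (extend (\<lambda>t. sqrt (ln (1 + ln (1 + t)))) (\<tau> \<omega>)) \<partial>M)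
          \<le> (\<integral>\<^sup>+ \<omega>. extend F (running_max (\<lambda>t. cmod (W t \<omega>) / sqrt (1 + t)) (\<tau> \<omega>)) \<partial>M)"
      using bound2 by (intro shrink) blast
    show "(\<integral>\<^sup>+ \<omega>. extend F (running_max (\<lambda>t. cmod (W t \<omega>) / sqrt (1 + t)) (\<tau> \<omega>)) \<partial>M)
          \<le> ennreal (max C1 C2) * (\<integral>\<^sup>+ \<omega>. extend F (extend (\<lambda>t. sqrt (ln (1 + ln (1 + t)))) (\<tau> \<omega>)) \<partial>M)"
      using bound2 by (intro enlarge) blast
  qed (use 1(1,2) 2(1,2) in auto)
qed

end
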